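(* Let $\chi$ be a real and non-principal Dirichlet character. Suppose that for some $0\le\sigma<1$ the partial sums $\sum_{p\le x}\chi(p)p^{-\sigma}$ (over primes $p$) change sign only for a finite number of integers $x\ge 1$. Then for some $\epsilon>0$ the series $\sum_{p\in\mathcal{P}}\chi(p)p^{-(1-\epsilon)}$ converges, and hence the Euler product formula $$L(s,\chi)=\prod_{p\in\mathcal{P}}\left(1-\frac{\chi(p)}{p^s}\right)^{-1}$$ holds for all $s\in\mathbb{C}$ with $\mathrm{Re}(s)>1-\epsilon$.
   Context: $\mathcal{P}$ denotes the set of prime numbers and $p$ a generic prime; series and products over $p\in\mathcal{P}$ are taken in increasing order of $p$ (convergence may be conditional). $L(s,\chi)$ is the Dirichlet $L$-function of $\chi$: $L(s,\chi)=\sum_{n=1}^\infty \chi(n)n^{-s}$, which for non-principal $\chi$ converges and is analytic for $\mathrm{Re}(s)>0$ (and is otherwise understood by analytic continuation). Saying that the partial sums $A(x)=\sum_{p\le x}\chi(p)p^{-\sigma}$ change sign only for a finite number of integers $x\ge1$ means that there is $x_0>0$ such that either $A(x)\ge 0$ for all $x\ge x_0$, or $A(x)\le 0$ for all $x\ge x_0$. *)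

theory Defs
  imports "HOL-Complex_Analysis.Complex_Analysis" "HOL-Computational_Algebra.Primes"
begin

text \<open>By periodicity a Dirichlet character is determined by its values on the natural numbers.
  The value \<open>chi 1 = 1\<close> follows from multiplicativity and \<open>chi 1 \<noteq> 0\<close>.\<close>

definition dirichlet_character :: "nat \<Rightarrow> (nat \<Rightarrow> complex) \<Rightarrow> bool" where
  "dirichlet_character N chi \<longleftrightarrow>
     N > 0 \<and>
     (\<forall>a b. chi (a * b) = chi a * chi b) \<and>
     (\<forall>a. chi (a + N) = chi a) \<and>
     (\<forall>a. chi a \<noteq> 0 \<longleftrightarrow> coprime a N)"

definition principal_character :: "nat \<Rightarrow> nat \<Rightarrow> complex" where
  "principal_character N = (\<lambda>a. if coprime a N then 1 else 0)"

definition real_character :: "(nat \<Rightarrow> complex) \<Rightarrow> bool" where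
  "real_character chi \<longleftrightarrow> (\<forall>a. chi a \<in> \<real>)"

definition dirichlet_L_term :: "(nat \<Rightarrow> complex) \<Rightarrow> complex \<Rightarrow> nat \<Rightarrow> complex" where
  "dirichlet_L_term chi s n = chi (Suc n) * of_nat (Suc n) powr (- s)"

text \<open>The sum of the Dirichlet series wherever the series converges (the half-plane
  \<open>Re s > 0\<close> for non-principal \<open>chi\<close>, and \<open>Re s > 1\<close> for principal \<open>chi\<close>), and otherwise the
  value of its analytic continuation. The point 1 is left out of the domain of the continuation
  because of the pole there for principal \<open>chi\<close>; only in that case is the value at 1 unspecified.\<close>

definition dirichlet_L :: "complex \<Rightarrow> (nat \<Rightarrow> complex) \<Rightarrow> complex" where
  "dirichlet_L s chi =
     (if summable (dirichlet_L_term chi s) then (\<Sum>n. dirichlet_L_term chi s n)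
      else (THE z. \<exists>f. f holomorphic_on (- {1}) \<and>
                       (\<forall>w. Re w > 1 \<longrightarrow> dirichlet_L_term chi w sums f w) \<and> z = f s))"

text \<open>The primes in increasing order, starting with \<open>nth_prime 0 = 2\<close>. Series and products
  over all primes are series and products over this enumeration.\<close>

definition nth_prime :: "nat \<Rightarrow> nat" where
  "nth_prime = enumerate {p. prime p}"

definition prime_partial_sum :: "(nat \<Rightarrow> complex) \<Rightarrow> real \<Rightarrow> real \<Rightarrow> complex" where
  "prime_partial_sum chi \<sigma> x =
     (\<Sum>p | prime p \<and> real p \<le> x. chi p * of_nat p powr (- of_real \<sigma>))"

definition finitely_many_sign_changes :: "(real \<Rightarrow> real) \<Rightarrow> bool" where
  "finitely_many_sign_changes A \<longleftrightarrow>
     (\<exists>x0>0. (\<forall>x\<ge>x0. A x \<ge> 0) \<or> (\<forall>x\<ge>x0. A x \<le> 0))"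

end

theory Submission
  imports Defs "HOL-Number_Theory.Residues"
begin

text \<open>Suppose \<open>A x = (\<Sum>p\<le>x. chi p / p powr \<sigma>)\<close> is eventually of one sign. For \<open>Re s > 1\<close> the series
  \<open>\<Sum> A n / n powr (s - \<sigma> + 1)\<close> differs from \<open>(\<Sum> chi p / p powr s) / (s - \<sigma>)\<close>, hence from
  \<open>ln (L s chi) / (s - \<sigma>)\<close>, by a function holomorphic for \<open>Re s > max \<sigma> (1/2)\<close>. As
  \<open>L 1 chi \<noteq> 0\<close> for real \<open>chi\<close>, it continues analytically across \<open>s = 1\<close>, and by Landau's theorem
  on nonnegative coefficients it converges at some real \<open>s0 < 1\<close>. Since \<open>A\<close> varies slowly, this
  forces \<open>A n = O(n powr (s1 - \<sigma>))\<close> with \<open>s1 = (1 + s0) / 2 < 1\<close>. Partial summation then gives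
  convergence of \<open>\<Sum> chi p / p powr s\<close> for \<open>Re s > s1\<close>, and the Euler product extends to this
  half-plane by the identity theorem.\<close>

section \<open>Dirichlet series and partial summation\<close>

text \<open>The signs of \<open>chi p\<close> are uncontrolled, so Landau's theorem says nothing
  about the prime series itself; it needs a genuine Dirichlet series with coefficients
  \<open>A n\<close>. Partial summation with w = s - \<sigma> only yields the weights n^(-w) -
  (n+1)^(-w). Replacing them by the linear Taylor term w n^(-w-1) leaves an error of order n^(-Re w
  - 2), and against the trivial bound |A n| \<le> n this sums for Re w > 0, hence to the left of s =
  1. The other abscissa 1/2 comes from the squares and higher powers of primes in ln L. Since L may
  vanish elsewhere, a logarithm is at hand only on a small disc about 1, which is why Landau's
  theorem is given for discs. Absence of zeros in the final half-plane is an outcome: the Euler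
  product there is an exponential. Landau's theorem controls A only on average. A pointwise bound
  costs half of the gain, because a large value of A persists only on a short interval; this is
  where the midpoint of s0 and 1 comes from.\<close>

text \<open>Weierstrass M-test in the shape needed three times: the quadratic factor absorbs the
  constants of a first or second derivative of \<open>n powr (-w)\<close>. As
  \<open>0 powr x = 0\<close>, the bound at \<open>n = 0\<close> forces \<open>f 0\<close> to vanish
  on the half-plane.\<close>

lemma holomorphic_on_suminf_half_plane:
  fixes f :: "nat \<Rightarrow> complex \<Rightarrow> complex"
  assumes holo: "\<And>n. f n holomorphic_on {w. Re w > \<beta>}"
    and bound: "\<And>n w. Re w > \<beta> \<Longrightarrow>
      norm (f n w) \<le> C * (1 + norm w)\<^sup>2 * real n powr (\<beta> - Re w - 1)"
  shows "(\<lambda>w. \<Sum>n. f n w) holomorphic_on {w. Re w > \<beta>}"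
    and "Re w > \<beta> \<Longrightarrow> summable (\<lambda>n. f n w)"
proof -
  show "(\<lambda>w. \<Sum>n. f n w) holomorphic_on {w. Re w > \<beta>}"
  proof (rule holomorphic_uniform_sequence)
    show "open {w. Re w > \<beta>}"
      by (simp add: open_halfspace_Re_gt)
    show "(\<lambda>w. \<Sum>i<n. f i w) holomorphic_on {w. Re w > \<beta>}" for n
      by (intro holomorphic_on_sum holo)
    fix z assume "z \<in> {w. Re w > \<beta>}"
    \<comment> \<open>Half the distance to the boundary line: on \<open>cball z d\<close> the
      exponent of \<open>n\<close> stays below \<open>-1 - d\<close>.\<close>
    define d where "d = (Re z - \<beta>) / 2"
    have d: "d > 0"
      using \<open>z \<in> _\<close> by (simp add: d_def)
    have Re: "Re w \<ge> \<beta> + d" if "w \<in> cball z d" for w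
    proof -
      have "\<bar>Re z - Re w\<bar> \<le> d"
        using that abs_Re_le_cmod[of "z - w"] by (simp add: dist_norm)
      moreover have "Re z = \<beta> + 2 * d"
        by (simp add: d_def field_simps)
      ultimately show ?thesis
        by linarith
    qed
    have "uniform_limit (cball z d) (\<lambda>n w. \<Sum>i<n. f i w) (\<lambda>w. \<Sum>n. f n w) sequentially"
    proof (rule Weierstrass_m_test)
      fix n w assume w: "w \<in> cball z d"
      have "norm w \<le> norm z + d"
        using w norm_triangle_ineq2[of w z] by (simp add: dist_norm norm_minus_commute)
      have "norm (f n w) \<le> C * (1 + norm w)\<^sup>2 * real n powr (\<beta> - Re w - 1)"
        using bound Re[OF w] d by fastforce
      also have "\<dots> \<le> \<bar>C\<bar> * (1 + (norm z + d))\<^sup>2 * real n powr (-1 - d)"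
      proof (cases "n = 0")
        case False
        then show ?thesis
          using Re[OF w] \<open>norm w \<le> norm z + d\<close>
          by (intro mult_mono power_mono powr_mono mult_nonneg_nonneg) auto
      qed simp
      finally show "norm (f n w) \<le> \<bar>C\<bar> * (1 + (norm z + d))\<^sup>2 * real n powr (-1 - d)" .
    next
      show "summable (\<lambda>n. \<bar>C\<bar> * (1 + (norm z + d))\<^sup>2 * real n powr (-1 - d))"
        using d by (intro summable_mult) (simp add: summable_real_powr_iff)
    qed
    moreover have "cball z d \<subseteq> {w. Re w > \<beta>}"
      using Re d by force
    ultimately show "\<exists>d>0. cball z d \<subseteq> {w. Re w > \<beta>} \<and>
        uniform_limit (cball z d) (\<lambda>n w. \<Sum>i<n. f i w) (\<lambda>w. \<Sum>n. f n w) sequentially"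
      using d by blast
  qed
  show "summable (\<lambda>n. f n w)" if "Re w > \<beta>"
  proof (rule summable_comparison_test')
    show "summable (\<lambda>n. C * (1 + norm w)\<^sup>2 * real n powr (\<beta> - Re w - 1))"
      using that by (intro summable_mult) (simp add: summable_real_powr_iff)
    show "\<And>n. n \<ge> 0 \<Longrightarrow> norm (f n w) \<le> C * (1 + norm w)\<^sup>2 * real n powr (\<beta> - Re w - 1)"
      using bound that by blast
  qed
qed

lemma norm_of_nat_powr: "norm (of_nat n powr w :: complex) = real n powr Re w"
  by (simp add: norm_powr_real_powr)

lemma has_field_derivative_powr_closed_segment:
  fixes w :: complex
  assumes "n > 0" "x \<in> closed_segment (of_nat n) (of_nat (Suc n))"
  shows "((\<lambda>x. x powr w) has_field_derivative w * x powr (w - 1)) (at x)"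
    and "norm (x powr w) = norm x powr Re w" and "norm x \<ge> real n"
proof -
  obtain u where u: "0 \<le> u" "u \<le> 1" "x = (1 - u) *\<^sub>R of_nat n + u *\<^sub>R of_nat (Suc n)"
    using assms(2) by (auto simp: closed_segment_def)
  have x: "x = of_real (real n + u)"
    by (simp add: u(3) scaleR_conv_of_real algebra_simps)
  have "x \<notin> \<real>\<^sub>\<le>\<^sub>0"
    using assms(1) u(1) by (auto simp: x complex_nonpos_Reals_iff)
  then show "((\<lambda>x. x powr w) has_field_derivative w * x powr (w - 1)) (at x)"
    by (rule has_field_derivative_powr)
  show "norm (x powr w) = norm x powr Re w"
    unfolding x norm_of_real using u(1) by (subst norm_powr_real_powr) auto
  show "norm x \<ge> real n"
    unfolding x norm_of_real using u(1) by simp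
qed

text \<open>Mean value inequality on the segment from n to n+1; \<open>Re w \<ge> -1\<close> makes
  the derivative bound largest at the left end.\<close>

lemma norm_powr_diff_le:
  fixes w :: complex
  assumes "n > 0" "Re w \<ge> -1"
  shows "norm (of_nat n powr (-w) - of_nat (Suc n) powr (-w)) \<le> norm w * real n powr (- Re w - 1)"
proof -
  define S where "S = closed_segment (of_nat n :: complex) (of_nat (Suc n))"
  have *: "((\<lambda>x. x powr (-w)) has_field_derivative -w * x powr (-w-1)) (at x within S)"
      "norm (-w * x powr (-w-1)) \<le> norm w * real n powr (- Re w - 1)" if "x \<in> S" for x
  proof -
    note D = has_field_derivative_powr_closed_segment[OF assms(1) that[unfolded S_def]]
    show "((\<lambda>x. x powr (-w)) has_field_derivative -w * x powr (-w-1)) (at x within S)"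
      using D(1) by (rule has_field_derivative_at_within)
    have "norm (x powr (-w-1)) \<le> real n powr (- Re w - 1)"
      using D(2)[of "-w-1"] D(3) assms by (auto intro!: powr_mono2')
    then show "norm (-w * x powr (-w-1)) \<le> norm w * real n powr (- Re w - 1)"
      by (simp add: norm_mult mult_left_mono)
  qed
  have "norm (of_nat n powr (-w) - of_nat (Suc n) powr (-w)) \<le>
      norm w * real n powr (- Re w - 1) * norm (of_nat n - of_nat (Suc n) :: complex)"
    using * by (intro field_differentiable_bound[where S = S and f' = "\<lambda>x. -w * x powr (-w-1)"])
      (auto simp: S_def)
  then show ?thesis
    by simp
qed

text \<open>Taylor expansion at n to first order, the remainder being bounded by the second
  derivative. This turns the weights of partial summation into powers of n.\<close>

lemma norm_powr_diff_diff_le: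
  fixes w :: complex
  assumes "n > 0" "Re w \<ge> -2"
  shows "norm (of_nat n powr (-w) - of_nat (Suc n) powr (-w) - w * of_nat n powr (-w-1))
    \<le> norm w * norm (w + 1) * real n powr (- Re w - 2)"
proof -
  define S where "S = closed_segment (of_nat n :: complex) (of_nat (Suc n))"
  \<comment> \<open>For i = 0, 1, 2 these are the successive derivatives of
    \<open>x powr (-w)\<close>.\<close>
  define f where "f i x = (if i = 0 then x powr (-w) else if i = 1 then -w * x powr (-w-1)
      else w * (w+1) * x powr (-w-2))" for i :: nat and x :: complex
  have "norm (f 0 (of_nat (Suc n)) - (\<Sum>i\<le>1. f i (of_nat n) * (of_nat (Suc n) - of_nat n) ^ i / fact i))
     \<le> norm w * norm (w + 1) * real n powr (- Re w - 2) * norm (of_nat (Suc n) - of_nat n :: complex) ^ Suc 1 / fact 1"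
  proof (rule complex_Taylor)
    show "convex S" "of_nat n \<in> S" "of_nat (Suc n) \<in> S"
      by (auto simp: S_def)
  next
    fix i x assume x: "x \<in> S" and i: "i \<le> (1 :: nat)"
    note D = has_field_derivative_powr_closed_segment(1)[OF assms(1) x[unfolded S_def]]
    have "((\<lambda>x. -w * x powr (-w-1)) has_field_derivative -w * ((-w-1) * x powr (-w-1-1))) (at x)"
      by (intro DERIV_cmult D)
    then have "((\<lambda>x. -w * x powr (-w-1)) has_field_derivative w * (w+1) * x powr (-w-2)) (at x)"
      by (simp add: algebra_simps)
    then show "(f i has_field_derivative f (Suc i) x) (at x within S)"
      using D[of "-w"] i unfolding f_def
      by (cases "i = 0") (auto intro: has_field_derivative_at_within)
  next
    fix x assume x: "x \<in> S"
    note D = has_field_derivative_powr_closed_segment[OF assms(1) x[unfolded S_def]]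
    have "norm (x powr (-w-2)) \<le> real n powr (- Re w - 2)"
      using D(2)[of "-w-2"] D(3) assms by (auto intro!: powr_mono2')
    then show "norm (f (Suc 1) x) \<le> norm w * norm (w + 1) * real n powr (- Re w - 2)"
      by (auto simp: f_def norm_mult intro!: mult_left_mono)
  qed
  then have "norm (of_nat (Suc n) powr (-w) - (of_nat n powr (-w) - w * of_nat n powr (-w-1)))
      \<le> norm w * norm (w + 1) * real n powr (- Re w - 2)"
    by (simp add: f_def)
  also have "of_nat (Suc n) powr (-w) - (of_nat n powr (-w) - w * of_nat n powr (-w-1)) =
     - (of_nat n powr (-w) - of_nat (Suc n) powr (-w) - w * of_nat n powr (-w-1))"
    by simp
  finally show ?thesis
    unfolding norm_minus_cancel .
qed

lemma sum_mult_by_parts: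
  fixes a g :: "nat \<Rightarrow> 'a :: comm_ring_1"
  shows "(\<Sum>n<m. a n * g n) = (\<Sum>n<m. (\<Sum>k\<le>n. a k) * (g n - g (Suc n))) + (\<Sum>k<m. a k) * g m"
proof (induction m)
  case (Suc m)
  have "(\<Sum>k\<le>m. a k) = (\<Sum>k<m. a k) + a m"
    by (simp add: lessThan_Suc_atMost[symmetric])
  then show ?case
    using Suc by (simp add: algebra_simps)
qed simp

text \<open>The given series may converge only conditionally, whereas its by-parts form
  \<open>D\<close> has terms of order n^(\<beta> - Re w - 1) and converges locally uniformly. The
  two agree because the boundary term is of order m^(\<beta> - Re w).\<close>

lemma
  fixes a :: "nat \<Rightarrow> complex"
  assumes a0: "a 0 = 0" and \<beta>: "\<beta> \<ge> 0"
    and bound: "\<And>n. norm (\<Sum>k\<le>n. a k) \<le> C * real n powr \<beta>"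
  defines "D \<equiv> \<lambda>w. \<Sum>n. (\<Sum>k\<le>n. a k) * (of_nat n powr (-w) - of_nat (Suc n) powr (-w))"
  shows holomorphic_on_dirichlet_series: "D holomorphic_on {w. Re w > \<beta>}"
    and dirichlet_series_sums: "Re w > \<beta> \<Longrightarrow> (\<lambda>n. a n * of_nat n powr (-w)) sums D w"
    and dirichlet_series_by_parts_summable: "Re w > \<beta> \<Longrightarrow>
      summable (\<lambda>n. (\<Sum>k\<le>n. a k) * (of_nat n powr (-w) - of_nat (Suc n) powr (-w)))"
proof -
  define f where "f n w = (\<Sum>k\<le>n. a k) * (of_nat n powr (-w) - of_nat (Suc n) powr (-w))" for n w
  have "norm (f n w) \<le> C * (1 + norm w)\<^sup>2 * real n powr (\<beta> - Re w - 1)" if "Re w > \<beta>" for n w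
  proof (cases "n = 0")
    case False
    have "C * real 1 powr \<beta> \<ge> 0"
      using bound[of 1] norm_ge_zero order_trans by blast
    then have C: "C \<ge> 0"
      by simp
    have "norm (f n w) \<le> C * real n powr \<beta> * (norm w * real n powr (- Re w - 1))"
      unfolding f_def norm_mult
      using that \<beta> False bound[of n] C by (intro mult_mono norm_powr_diff_le) auto
    also have "\<dots> = C * norm w * real n powr (\<beta> - Re w - 1)"
      using False by (simp add: powr_add[symmetric] algebra_simps)
    also have "\<dots> \<le> C * (1 + norm w)\<^sup>2 * real n powr (\<beta> - Re w - 1)"
      using C by (intro mult_right_mono mult_left_mono)
        (auto simp: power2_eq_square algebra_simps)
    finally show ?thesis .
  qed (simp add: f_def a0)
  moreover have "f n holomorphic_on {w. Re w > \<beta>}" for n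
    unfolding f_def by (cases "n = 0") (auto simp: a0 intro!: holomorphic_intros)
  ultimately have *: "D holomorphic_on {w. Re w > \<beta>}"
      and summ: "\<And>w. Re w > \<beta> \<Longrightarrow> summable (\<lambda>n. f n w)"
    using holomorphic_on_suminf_half_plane[where f = f and \<beta> = \<beta> and C = C]
    unfolding D_def f_def by blast+
  then show "D holomorphic_on {w. Re w > \<beta>}"
    by blast
  show "summable (\<lambda>n. (\<Sum>k\<le>n. a k) * (of_nat n powr (-w) - of_nat (Suc n) powr (-w)))" if "Re w > \<beta>"
    using summ[OF that] by (simp add: f_def)
  show "(\<lambda>n. a n * of_nat n powr (-w)) sums D w" if w: "Re w > \<beta>"
  proof -
    have "(\<lambda>m. (\<Sum>k<m. a k) * of_nat m powr (-w)) \<longlonglongrightarrow> 0"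
    proof (rule LIMSEQ_imp_Suc, rule Lim_null_comparison)
      show "(\<lambda>n. C * real (Suc n) powr (\<beta> - Re w)) \<longlonglongrightarrow> 0"
        using w by (intro tendsto_mult_right_zero tendsto_neg_powr filterlim_compose[OF filterlim_real_sequentially filterlim_Suc]) auto
      have "norm ((\<Sum>k<Suc n. a k) * of_nat (Suc n) powr (-w)) \<le> C * real (Suc n) powr (\<beta> - Re w)" for n
      proof -
        have "C * real 1 powr \<beta> \<ge> 0"
          using bound[of 1] norm_ge_zero order_trans by blast
        then have C: "C \<ge> 0"
          by simp
        have "norm (\<Sum>k<Suc n. a k) \<le> C * real n powr \<beta>"
          using bound[of n] by (simp only: lessThan_Suc_atMost)
        also have "\<dots> \<le> C * real (Suc n) powr \<beta>"
          using C \<beta> by (intro mult_left_mono powr_mono2) auto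
        finally have "norm ((\<Sum>k<Suc n. a k) * of_nat (Suc n) powr (-w)) \<le>
           (C * real (Suc n) powr \<beta>) * real (Suc n) powr (- Re w)"
          unfolding norm_mult norm_of_nat_powr using C by (intro mult_mono) auto
        then show ?thesis
          by (simp add: mult.assoc powr_add[symmetric] del: of_nat_Suc)
      qed
      then show "\<forall>\<^sub>F n in sequentially. norm ((\<Sum>k<Suc n. a k) * of_nat (Suc n) powr (-w))
          \<le> C * real (Suc n) powr (\<beta> - Re w)"
        by (intro always_eventually) blast
    qed
    moreover have "(\<lambda>m. \<Sum>n<m. f n w) \<longlonglongrightarrow> D w"
      using summable_sums[OF summ[OF w]] by (simp add: sums_def D_def f_def)
    ultimately have "(\<lambda>m. (\<Sum>n<m. f n w) + (\<Sum>k<m. a k) * of_nat m powr (-w)) \<longlonglongrightarrow> D w + 0"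
      by (intro tendsto_add)
    then show ?thesis
      unfolding sums_def f_def by (subst sum_mult_by_parts) simp
  qed
qed

text \<open>The second-order error gains two powers of n and the growth of \<open>A\<close> loses
  one, so that Re w > 0 suffices for convergence.\<close>

lemma
  fixes A :: "nat \<Rightarrow> complex"
  assumes bound: "\<And>n. norm (A n) \<le> real n"
  defines "f \<equiv> \<lambda>n w. A n * (of_nat n powr (-w) - of_nat (Suc n) powr (-w) - w * of_nat n powr (-w-1))"
  shows holomorphic_on_second_difference_series: "(\<lambda>w. \<Sum>n. f n w) holomorphic_on {w. Re w > 0}"
    and second_difference_series_summable: "Re w > 0 \<Longrightarrow> summable (\<lambda>n. f n w)"
proof -
  have A0: "A 0 = 0"
    using bound[of 0] by simp
  have *: "norm (f n w) \<le> 1 * (1 + norm w)\<^sup>2 * real n powr (0 - Re w - 1)" if "Re w > 0" for n w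
  proof (cases "n = 0")
    case False
    have "norm (f n w) \<le> real n * (norm w * norm (w + 1) * real n powr (- Re w - 2))"
      unfolding f_def norm_mult[of "A n"]
      using that False bound[of n] by (intro mult_mono norm_powr_diff_diff_le) auto
    also have "\<dots> = norm w * norm (w + 1) * real n powr (0 - Re w - 1)"
      using False by (simp add: powr_diff field_simps power2_eq_square)
    also have "\<dots> \<le> (1 + norm w) * (1 + norm w) * real n powr (0 - Re w - 1)"
      using norm_triangle_ineq[of w 1] by (intro mult_right_mono mult_mono) auto
    finally show ?thesis
      by (simp add: power2_eq_square)
  qed (simp add: f_def A0)
  moreover have **: "f n holomorphic_on {w. Re w > 0}" for n
    unfolding f_def by (cases "n = 0") (auto simp: A0 intro!: holomorphic_intros)
  show "(\<lambda>w. \<Sum>n. f n w) holomorphic_on {w. Re w > 0}"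
    using holomorphic_on_suminf_half_plane(1)[of f 0 1, OF ** *] by blast
  show "summable (\<lambda>n. f n w)" if "Re w > 0"
    using holomorphic_on_suminf_half_plane(2)[of f 0 1, OF ** *] that by blast
qed

section \<open>Landau's theorem\<close>

lemma power_series_coeff_unique:
  fixes e :: "nat \<Rightarrow> complex"
  assumes "r > 0"
    and sums: "\<And>z. norm z < r \<Longrightarrow> (\<lambda>k. e k * z ^ k) sums H z"
  shows "e k = (deriv ^^ k) H 0 / fact k"
proof -
  have "H has_fps_expansion Abs_fps e"
    unfolding has_fps_expansion_def
  proof
    have "conv_radius e \<ge> ereal r"
      using sums by (intro conv_radius_geI_ex') (auto simp: sums_iff)
    then show "fps_conv_radius (Abs_fps e) > 0"
      using \<open>r > 0\<close> by (simp add: fps_conv_radius_def) (metis ereal_less(2) less_le_trans)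
    have "\<forall>\<^sub>F z in nhds 0. z \<in> ball (0 :: complex) r"
      using \<open>r > 0\<close> by (intro eventually_nhds_in_open) auto
    then show "\<forall>\<^sub>F z in nhds 0. eval_fps (Abs_fps e) z = H z"
      by eventually_elim (use sums in \<open>auto simp: eval_fps_def sums_iff\<close>)
  qed
  from fps_nth_fps_expansion[OF this, of k] show ?thesis
    by simp
qed

text \<open>Writing n^(-(s-z)) = n^(-s) exp (z ln n) turns the Dirichlet series into a double series
  in (n, k). Near z = 0 summation over n first is legitimate and gives the Taylor coefficients of F
  (s - z), all nonnegative. The Taylor series converges in the whole disc of holomorphy, and at z =
  s - x \<ge> 0 nonnegativity allows the order to be swapped back.\<close>

lemma landau_dirichlet_series:
  fixes b :: "nat \<Rightarrow> real"
  assumes nonneg: "\<And>n. b n \<ge> 0" and "r > 0"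
    and sums: "\<And>t. t \<in> ball (of_real s) r \<Longrightarrow> (\<lambda>n. of_real (b n) * of_nat n powr (-t)) sums F t"
    and holo: "F holomorphic_on ball (of_real s) R"
    and x: "s - R < x" "x \<le> s"
  shows "summable (\<lambda>n. b n * real n powr (-x))"
proof -
  \<comment> \<open>The coefficient of z^k in \<open>b n * real n powr (-(s - z))\<close>. It is
    nonnegative because ln n \<ge> 0 for n \<ge> 1 and the factor \<open>real n powr (-s)\<close> is
    0 at n = 0.\<close>
  define d where "d n k = b n * real n powr (-s) * ln (real n) ^ k / fact k" for n k :: nat
  have d_nonneg: "d n k \<ge> 0" for n k
    using nonneg[of n] by (cases "n = 0") (auto simp: d_def)
  have d_sums: "((\<lambda>k. d n k * z ^ k) has_sum (b n * real n powr (-(s - z)))) UNIV" if "z \<ge> 0" for n z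
  proof (rule sums_nonneg_imp_has_sum)
    have "(\<lambda>k. b n * real n powr (-s) * ((ln (real n) * z) ^ k / fact k)) sums
        (b n * real n powr (-s) * exp (ln (real n) * z))"
      using exp_converges[of "ln (real n) * z"] by (intro sums_mult) (simp add: field_simps)
    moreover have "real n powr (-s) * exp (ln (real n) * z) = real n powr (-(s - z))"
      by (cases "n = 0") (auto simp: powr_def exp_add[symmetric] algebra_simps)
    ultimately show "(\<lambda>k. d n k * z ^ k) sums (b n * real n powr (-(s - z)))"
      by (simp add: d_def power_mult_distrib mult.assoc)
    show "d n k * z ^ k \<ge> 0" for k
      using that d_nonneg by simp
  qed
  have cd_sums: "((\<lambda>k. of_real (d n k) * z ^ k) has_sum (of_real (b n) * of_nat n powr (-(of_real s - z)))) UNIV"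
    for n and z :: complex
  proof (rule norm_summable_imp_has_sum)
    have "(\<lambda>k. of_real (b n * real n powr (-s)) * ((of_real (ln (real n)) * z) ^ k / fact k)) sums
        (of_real (b n * real n powr (-s)) * exp (of_real (ln (real n)) * z))"
      using exp_converges[of "of_real (ln (real n)) * z"] by (intro sums_mult) (simp add: scaleR_conv_of_real field_simps)
    moreover have "of_real (real n powr (-s)) * exp (of_real (ln (real n)) * z) = of_nat n powr (-(of_real s - z))"
    proof (cases "n = 0")
      case False
      then have "of_real (real n powr (-s)) = (of_nat n powr of_real (-s) :: complex)"
        by (simp add: powr_of_real[symmetric])
      then show ?thesis
        using False by (simp add: powr_def exp_add[symmetric] algebra_simps Ln_of_nat)
    qed auto
    ultimately show "(\<lambda>k. of_real (d n k) * z ^ k) sums (of_real (b n) * of_nat n powr (-(of_real s - z)))"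
      by (simp add: d_def power_mult_distrib mult.assoc)
    show "summable (\<lambda>k. norm (of_real (d n k) * z ^ k))"
      using has_sum_imp_sums[OF d_sums[of "norm z" n]] d_nonneg
      by (simp add: norm_mult norm_power sums_iff)
  qed
  have row: "(\<lambda>n. b n * real n powr (-(s - z))) summable_on UNIV" if "0 \<le> z" "z < r" for z
  proof (rule summable_nonneg_imp_summable_on)
    have "(\<lambda>n. of_real (b n) * of_nat n powr (-of_real (s - z))) sums F (of_real (s - z))"
      using that by (intro sums) (simp add: dist_norm flip: of_real_diff)
    then have "summable (\<lambda>n. Re (of_real (b n) * of_nat n powr (-of_real (s - z))))"
      using sums_Re sums_iff by blast
    moreover have "Re (of_real (b n) * of_nat n powr (-of_real (s - z) :: complex)) = b n * real n powr (-(s - z))" for n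
    proof -
      have "of_nat n powr (-of_real (s - z)) = (of_real (real n powr (-(s - z))) :: complex)"
        by (simp add: powr_of_real[symmetric])
      then show ?thesis
        by simp
    qed
    ultimately show "summable (\<lambda>n. b n * real n powr (-(s - z)))"
      by (simp only:)
  qed (simp add: nonneg)
  have double: "(\<lambda>(n, k). d n k * z ^ k) summable_on UNIV \<times> UNIV" if "0 \<le> z" "z < r" for z
    using d_nonneg d_sums[OF that(1)] that by (intro summable_on_SigmaI[OF _ row[of z]]) auto
  define e where "e k = (\<Sum>\<^sub>\<infinity>n. d n k)" for k
  have e: "((\<lambda>n. d n k) has_sum e k) UNIV" for k
  proof -
    \<comment> \<open>Any point of (0, r) would do: its k-th power is a nonzero constant in each
      column and cancels.\<close>
    have "(\<lambda>(n, k). d n k * (r/2) ^ k) summable_on UNIV \<times> UNIV"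
      using \<open>r > 0\<close> by (intro double) auto
    then have "(\<lambda>(k, n). d n k * (r/2) ^ k) summable_on UNIV \<times> UNIV"
      using summable_on_swap by fastforce
    from summable_on_SigmaD1[OF this, of k] have "(\<lambda>n. d n k * (r/2) ^ k) summable_on UNIV"
      by simp
    then have "(\<lambda>n. d n k) summable_on UNIV"
      using \<open>r > 0\<close> by (subst (asm) summable_on_cmult_left') auto
    then show ?thesis
      by (simp add: e_def)
  qed
  define H where "H z = F (of_real s - z)" for z
  have H_sums: "(\<lambda>k. of_real (e k) * z ^ k) sums H z" if "norm z < r" for z
  proof (rule has_sum_imp_sums)
    have "(\<lambda>(n, k). of_real (d n k) * z ^ k) summable_on UNIV \<times> UNIV"
    proof -
      have "(\<lambda>x. norm (case x of (n, k) \<Rightarrow> d n k * norm z ^ k)) summable_on UNIV \<times> UNIV"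
        using double[of "norm z"] that by (subst (asm) summable_on_iff_abs_summable_on_real) auto
      then have "(\<lambda>x. norm (case x of (n, k) \<Rightarrow> of_real (d n k) * z ^ k)) summable_on UNIV \<times> UNIV"
        by (rule Infinite_Sum.abs_summable_on_comparison_test) (auto simp: norm_mult norm_power)
      then show ?thesis
        by (rule Infinite_Sum.abs_summable_summable)
    qed
    then obtain S where S: "((\<lambda>(n, k). of_real (d n k) * z ^ k) has_sum S) (UNIV \<times> UNIV)"
      by (auto simp: summable_on_def)
    have "((\<lambda>n. of_real (b n) * of_nat n powr (-(of_real s - z))) has_sum S) UNIV"
      using has_sum_SigmaD[OF S] cd_sums by auto
    from has_sum_imp_sums[OF this] have "S = H z"
      using that sums[of "of_real s - z"] by (auto simp: H_def dist_norm sums_iff)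
    from S have "((\<lambda>(k, n). of_real (d n k) * z ^ k) has_sum S) (UNIV \<times> UNIV)"
      using has_sum_swap by fastforce
    moreover have "((\<lambda>n. of_real (d n k) * z ^ k) has_sum (of_real (e k) * z ^ k)) UNIV" for k
      by (intro has_sum_cmult_left has_sum_of_real e)
    ultimately show "((\<lambda>k. of_real (e k) * z ^ k) has_sum H z) UNIV"
      using has_sum_SigmaD[where f = "\<lambda>(k, n). of_real (d n k) * z ^ k" and A = UNIV and B = "\<lambda>_. UNIV"]
        \<open>S = H z\<close> by fastforce
  qed
  have holo_H: "H holomorphic_on ball 0 R"
  proof -
    have "F \<circ> (\<lambda>z. of_real s - z) holomorphic_on ball 0 R"
      by (rule holomorphic_on_compose_gen[OF _ holo]) (auto simp: dist_norm intro!: holomorphic_intros)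
    then show ?thesis
      by (simp add: H_def[abs_def] o_def)
  qed
  have "norm (of_real (s - x) :: complex) < R"
    using x by (simp only: norm_of_real)
  \<comment> \<open>This is the step beyond the known region: the Taylor series of \<open>H\<close>
    converges out to radius \<open>R\<close>, and its coefficients are \<open>e k\<close> by
    uniqueness on the disc of radius \<open>r\<close>.\<close>
  then have "(\<lambda>k. of_real (e k) * of_real (s - x) ^ k) sums H (of_real (s - x))"
    using holomorphic_power_series[OF holo_H, of "of_real (s - x)"]
      power_series_coeff_unique[OF \<open>r > 0\<close> H_sums]
    by simp
  from sums_Re[OF this] have "summable (\<lambda>k. e k * (s - x) ^ k)"
    by (simp add: sums_iff flip: of_real_power)
  moreover have "e k \<ge> 0" for k
    using e[of k] d_nonneg by (intro has_sum_nonneg[OF e]) auto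
  ultimately have "(\<lambda>k. e k * (s - x) ^ k) summable_on UNIV"
    using x by (intro summable_nonneg_imp_summable_on) auto
  then have "(\<lambda>(k, n). d n k * (s - x) ^ k) summable_on UNIV \<times> UNIV"
    using x d_nonneg has_sum_cmult_left[OF e] by (intro summable_on_SigmaI[where g = "\<lambda>k. e k * (s - x) ^ k"]) auto
  then have "(\<lambda>(n, k). d n k * (s - x) ^ k) summable_on UNIV \<times> UNIV"
    using summable_on_swap by fastforce
  then have "(\<lambda>n. \<Sum>\<^sub>\<infinity>k. d n k * (s - x) ^ k) summable_on UNIV"
    using summable_on_SigmaD[of "\<lambda>(n, k). d n k * (s - x) ^ k" UNIV "\<lambda>_. UNIV"]
       d_sums[of "s - x"] x by (auto simp: has_sum_iff)
  moreover have "(\<Sum>\<^sub>\<infinity>k. d n k * (s - x) ^ k) = b n * real n powr (-x)" for n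
    using d_sums[of "s - x" n] x by (auto simp: has_sum_iff)
  ultimately show ?thesis
    by (simp add: summable_on_imp_summable)
qed

section \<open>Non-vanishing at 1 for real characters\<close>

text \<open>Pairing index j with n - 1 - j, the two terms have geometric mean y^(n-1). With y = sqrt
  x this bounds 1 + x + ... + x^(n-1) from below sharply enough for the monotonicity in Monsky's
  argument.\<close>

lemma sum_power_two_sided_AM_GM:
  fixes y :: real
  assumes "y \<ge> 0"
  shows "real n * y ^ (n - 1) \<le> (\<Sum>j<n. (y\<^sup>2) ^ j)"
proof -
  have "(\<Sum>j<n. 2 * y ^ (n - 1)) \<le> (\<Sum>j<n. (y\<^sup>2) ^ j + (y\<^sup>2) ^ (n - 1 - j))"
  proof (rule sum_mono)
    fix j assume "j \<in> {..<n}"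
    then have "y ^ (n - 1) = y ^ j * y ^ (n - 1 - j)"
      by (simp flip: power_add)
    moreover have "(y\<^sup>2) ^ i = (y ^ i)\<^sup>2" for i
      by (simp add: mult.commute flip: power_mult)
    ultimately show "2 * y ^ (n - 1) \<le> (y\<^sup>2) ^ j + (y\<^sup>2) ^ (n - 1 - j)"
      using sum_squares_bound[of "y ^ j" "y ^ (n - 1 - j)"] by simp
  qed
  also have "\<dots> = (\<Sum>j<n. (y\<^sup>2) ^ j) + (\<Sum>j<n. (y\<^sup>2) ^ (n - Suc j))"
    by (simp add: sum.distrib)
  also have "(\<Sum>j<n. (y\<^sup>2) ^ (n - Suc j)) = (\<Sum>j<n. (y\<^sup>2) ^ j)"
    by (rule sum.nat_diff_reindex)
  finally show ?thesis
    by simp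
qed

text \<open>Abel's inequality: after partial summation the differences of \<open>c\<close> are
  nonnegative and telescope to \<open>c 0\<close>.\<close>

lemma abs_sum_mult_antimono_le:
  fixes a c :: "nat \<Rightarrow> real"
  assumes "antimono c" and nonneg: "\<And>n. c n \<ge> 0" and bound: "\<And>n. \<bar>\<Sum>k\<le>n. a k\<bar> \<le> B"
  shows "\<bar>\<Sum>n<m. a n * c n\<bar> \<le> B * c 0"
proof -
  have c: "c (Suc n) \<le> c n" for n
    using assms(1) by (simp add: antimono_def)
  have B: "B \<ge> 0"
    using bound[of 0] by simp
  have "\<bar>\<Sum>k<m. a k\<bar> \<le> B"
    using bound[of "m - 1"] B by (cases m) (auto simp: lessThan_Suc_atMost)
  have "\<bar>\<Sum>n<m. a n * c n\<bar> \<le> \<bar>\<Sum>n<m. (\<Sum>k\<le>n. a k) * (c n - c (Suc n))\<bar> + \<bar>(\<Sum>k<m. a k) * c m\<bar>"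
    by (subst sum_mult_by_parts) (rule abs_triangle_ineq)
  also have "\<dots> \<le> (\<Sum>n<m. B * (c n - c (Suc n))) + B * c m"
  proof (intro add_mono order_trans[OF sum_abs] sum_mono)
    show "\<bar>(\<Sum>k\<le>n. a k) * (c n - c (Suc n))\<bar> \<le> B * (c n - c (Suc n))" for n
      using bound[of n] c[of n] by (simp add: abs_mult mult_right_mono)
    show "\<bar>(\<Sum>k<m. a k) * c m\<bar> \<le> B * c m"
      using \<open>\<bar>\<Sum>k<m. a k\<bar> \<le> B\<close> nonneg[of m] by (simp add: abs_mult mult_right_mono)
  qed
  also have "\<dots> = B * c 0"
    by (simp only: sum_distrib_left[symmetric] sum_lessThan_telescope') (simp add: algebra_simps)
  finally show ?thesis .
qed

text \<open>Splitting off the full power of one prime at a time reduces statements on multiplicative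
  functions to prime powers.\<close>

lemma prime_power_mult_induct [consumes 1, case_names one step]:
  assumes "n > (0 :: nat)" and "P 1"
    and "\<And>p k m. prime p \<Longrightarrow> \<not> p dvd m \<Longrightarrow> m > 0 \<Longrightarrow> P m \<Longrightarrow> P (p ^ k * m)"
  shows "P n"
  using assms(1)
proof (induction n rule: less_induct)
  case (less n)
  show ?case
  proof (cases "n = 1")
    case False
    then obtain p where p: "prime p" "p dvd n"
      using prime_factor_nat by blast
    define k where "k = multiplicity p n"
    obtain m where m: "n = p ^ k * m" "\<not> p dvd m"
      using multiplicity_decompose'[of n p] less.prems p(1) not_prime_unit unfolding k_def by blast
    have "k > 0"
      using p less.prems by (simp add: k_def prime_multiplicity_gt_zero_iff)
    then have "1 < p ^ k"
      using p(1) by (intro one_less_power prime_gt_1_nat)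
    moreover have "m > 0"
      using m(1) less.prems by (intro Nat.gr0I) auto
    ultimately have "1 * m < p ^ k * m"
      by (intro mult_strict_right_mono)
    then have "m < n"
      by (simp add: m(1))
    then have "P m"
      using less.IH \<open>m > 0\<close> by blast
    then have "P (p ^ k * m)"
      by (rule assms(3)[OF p(1) m(2) \<open>m > 0\<close>])
    then show ?thesis
      by (simp only: m(1))
  qed (use assms(2) in simp)
qed

section \<open>Divisor sums of a completely multiplicative function and their Lambert series\<close>

context
  fixes f :: "nat \<Rightarrow> real"
  assumes f_mult: "\<And>a b. f (a * b) = f a * f b"
    and f_values: "\<And>a. f a \<in> {-1, 0, 1}"
    and f_1: "f 1 = 1" and f_0: "f 0 = 0"
begin

lemma multiplicative_power: "f (a ^ k) = f a ^ k"
  by (induction k) (use f_1 in \<open>auto simp: f_mult\<close>)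

text \<open>Each divisor is \<open>p ^ j * d\<close> for exactly one pair: the multiplicity of
  \<open>p\<close> recovers j, and cancellation recovers d.\<close>

lemma divisor_sum_prime_power_mult:
  assumes p: "prime p" "\<not> p dvd m" and m: "m > 0"
  shows "(\<Sum>d | d dvd p ^ k * m. f d) = (\<Sum>j\<le>k. f p ^ j) * (\<Sum>d | d dvd m. f d)"
proof -
  have "bij_betw (\<lambda>(j, d). p ^ j * d) ({..k} \<times> {d. d dvd m}) {d. d dvd p ^ k * m}"
    unfolding bij_betw_def
  proof
    have mult: "multiplicity p (p ^ j * d) = j" if "d dvd m" for j d
    proof -
      have "\<not> p dvd d" "d \<noteq> 0"
        using p that m by (auto intro: dvd_trans)
      then show ?thesis
        using p(1) by (simp add: prime_elem_multiplicity_mult_distrib not_dvd_imp_multiplicity_0)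
    qed
    show "inj_on (\<lambda>(j, d). p ^ j * d) ({..k} \<times> {d. d dvd m})"
    proof (rule inj_onI, clarify)
      fix i d j e assume *: "d dvd m" "e dvd m" "p ^ i * d = p ^ j * e"
      then have "i = j"
        using mult[of d i] mult[of e j] by simp
      moreover from this have "d = e"
        using *(3) prime_gt_0_nat[OF p(1)] by simp
      ultimately show "i = j \<and> d = e" ..
    qed
    show "(\<lambda>(j, d). p ^ j * d) ` ({..k} \<times> {d. d dvd m}) = {d. d dvd p ^ k * m}"
    proof safe
      fix j d assume "j \<le> k" "d dvd m"
      then show "p ^ j * d dvd p ^ k * m"
        by (intro mult_dvd_mono le_imp_power_dvd)
    next
      fix d assume "d dvd p ^ k * m"
      then obtain b c where "d = b * c" "b dvd p ^ k" "c dvd m"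
        using division_decomp by blast
      moreover from this obtain j where "b = p ^ j" "j \<le> k"
        using p(1) by (auto simp: divides_primepow_nat)
      ultimately show "d \<in> (\<lambda>(j, d). p ^ j * d) ` ({..k} \<times> {d. d dvd m})"
        by (intro image_eqI[of _ _ "(j, c)"]) auto
    qed
  qed
  then have "(\<Sum>d | d dvd p ^ k * m. f d) = (\<Sum>(j, d)\<in>{..k} \<times> {d. d dvd m}. f (p ^ j * d))"
    by (subst sum.reindex_bij_betw[symmetric]) (auto simp: case_prod_unfold)
  also have "\<dots> = (\<Sum>j\<le>k. f p ^ j) * (\<Sum>d | d dvd m. f d)"
    by (simp add: f_mult multiplicative_power sum_product sum.cartesian_product)
  finally show ?thesis .
qed

text \<open>The local factor at p^k is k + 1, 1, or an alternating sum equal to 0 or 1, according to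
  the value of \<open>f p\<close>.\<close>

lemma divisor_sum_nonneg:
  assumes "n > 0"
  shows "(\<Sum>d | d dvd n. f d) \<ge> 0"
  using assms
proof (induction n rule: prime_power_mult_induct)
  case (step p k m)
  have "(\<Sum>j\<le>k. x ^ j) \<ge> 0" if "x \<in> {-1, 0, 1}" for x :: real
  proof -
    have "(\<Sum>j\<le>k. (-1) ^ j) = (if even k then 1 else 0 :: real)"
      by (induction k) auto
    moreover have "(\<Sum>j\<le>k. x ^ j) \<ge> 0" if "x \<ge> 0"
      using that by (intro sum_nonneg) auto
    ultimately show ?thesis
      using that by auto
  qed
  from this[OF f_values[of p]] show ?case
    using step by (simp add: divisor_sum_prime_power_mult)
qed (use f_1 in simp)

text \<open>In a square all exponents are even, so the alternating local factor is 1 rather than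
  0.\<close>

lemma divisor_sum_square_ge_1:
  assumes "n > 0"
  shows "(\<Sum>d | d dvd n\<^sup>2. f d) \<ge> 1"
  using assms
proof (induction n rule: prime_power_mult_induct)
  case (step p k m)
  have "(\<Sum>j\<le>2 * k. x ^ j) \<ge> 1" if "x \<in> {-1, 0, 1}" for x :: real
  proof -
    have "(\<Sum>j\<le>2 * k. (-1) ^ j) = (1 :: real)" "(\<Sum>j\<le>2 * k. 0 ^ j) = (1 :: real)"
      by (induction k) auto
    then show ?thesis
      using that by auto
  qed
  from this[OF f_values[of p]] have "1 * 1 \<le> (\<Sum>j\<le>2 * k. f p ^ j) * (\<Sum>d | d dvd m\<^sup>2. f d)"
    using step by (intro mult_mono) auto
  moreover have "\<not> p dvd m\<^sup>2"
    using step by (simp add: prime_dvd_power_iff)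
  ultimately show ?case
    using step divisor_sum_prime_power_mult[of p "m\<^sup>2" "2 * k"]
    by (simp add: power_mult_distrib power_mult[symmetric] mult.commute)
qed (use f_1 in simp)

text \<open>Expanding x^n / (1 - x^n) geometrically and collecting equal exponents gives a power
  series whose coefficients are the divisor sums of \<open>f\<close>. These are nonnegative and at
  least 1 at squares, so keeping only the squares gives the lower bound.\<close>

lemma lambert_series:
  assumes x: "0 < x" "x < 1"
  obtains T where "(\<lambda>n. f n * (x ^ n / (1 - x ^ n))) sums T"
    and "\<And>M. (\<Sum>q = 1..M. x ^ q\<^sup>2) \<le> T"
proof -
  \<comment> \<open>The pair (n, j) encodes the factorisation m = n (j+1), so that j = m div n - 1
    in the regrouping by m.\<close>
  define h where "h = (\<lambda>(n, j). f n * x ^ (n * Suc j))"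
  have f_le: "\<bar>f n\<bar> \<le> 1" for n
    using f_values[of n] by auto
  have row: "((\<lambda>j. x ^ (n * Suc j)) has_sum (x ^ n / (1 - x ^ n))) UNIV" if "n \<in> {1..}" for n
  proof (rule sums_nonneg_imp_has_sum)
    have "x ^ n < 1"
      using x that by (simp add: power_less_one_iff)
    then have "(\<lambda>j. x ^ n * (x ^ n) ^ j) sums (x ^ n * (1 / (1 - x ^ n)))"
      using x by (intro sums_mult geometric_sums) auto
    then show "(\<lambda>j. x ^ (n * Suc j)) sums (x ^ n / (1 - x ^ n))"
      by (simp add: power_add power_mult)
  qed (use x in auto)
  have "(\<lambda>(n, j). x ^ (n * Suc j)) summable_on {1..} \<times> UNIV"
  proof (rule summable_on_SigmaI)
    show "((\<lambda>j. (\<lambda>(n, j). x ^ (n * Suc j)) (n, j)) has_sum (x ^ n / (1 - x ^ n))) UNIV" if "n \<in> {1..}" for n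
      using row[OF that] by simp
    have "(\<lambda>n. x ^ n / (1 - x)) summable_on UNIV"
      using x by (intro summable_nonneg_imp_summable_on summable_divide summable_geometric) auto
    then have "(\<lambda>n. x ^ n / (1 - x)) summable_on {1..}"
      by (rule summable_on_subset_banach) auto
    then show "(\<lambda>n. x ^ n / (1 - x ^ n)) summable_on {1..}"
    proof (rule summable_on_comparison_test)
      fix n :: nat assume "n \<in> {1..}"
      then have "x ^ n \<le> x ^ 1"
        using x by (intro power_decreasing) auto
      then show "x ^ n / (1 - x ^ n) \<le> x ^ n / (1 - x)" "0 \<le> x ^ n / (1 - x ^ n)"
        using x by (auto intro!: divide_left_mono mult_pos_pos divide_nonneg_nonneg)
    qed
  qed (use x in auto)
  then have "(\<lambda>y. norm (case y of (n, j) \<Rightarrow> x ^ (n * Suc j))) summable_on {1..} \<times> UNIV"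
    by (subst (asm) summable_on_iff_abs_summable_on_real)
  then have "(\<lambda>y. norm (h y)) summable_on {1..} \<times> UNIV"
    by (rule Infinite_Sum.abs_summable_on_comparison_test)
      (use x f_le in \<open>auto simp: h_def abs_mult mult_le_cancel_right1\<close>)
  then obtain T where T: "(h has_sum T) ({1..} \<times> UNIV)"
    using Infinite_Sum.abs_summable_summable summable_on_def by blast
  have "((\<lambda>j. h (n, j)) has_sum (f n * (x ^ n / (1 - x ^ n)))) UNIV" if "n \<in> {1..}" for n
    using has_sum_cmult_right[OF row[OF that], of "f n"] by (simp only: h_def prod.case)
  then have "((\<lambda>n. f n * (x ^ n / (1 - x ^ n))) has_sum T) {1..}"
    by (rule has_sum_SigmaD[OF T])
  then have "((\<lambda>n. f n * (x ^ n / (1 - x ^ n))) has_sum T) UNIV"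
    by (rule has_sum_cong_neutral[THEN iffD1, rotated -1]) (auto simp: f_0 not_le)
  then have 1: "(\<lambda>n. f n * (x ^ n / (1 - x ^ n))) sums T"
    by (rule has_sum_imp_sums)
  have div: "d * Suc (m div d - 1) = m" "d \<ge> 1" if m: "m \<ge> 1" "d dvd m" for m d :: nat
  proof -
    obtain k where "m = d * k"
      using m(2) by blast
    moreover from this m(1) have "d > 0" "k > 0"
      by (simp_all add: Suc_le_eq)
    ultimately show "d * Suc (m div d - 1) = m" "d \<ge> 1"
      by simp_all
  qed
  have "(h has_sum T) ({1..} \<times> UNIV) \<longleftrightarrow> ((\<lambda>(m, d). f d * x ^ m) has_sum T) (SIGMA m:{1..}. {d. d dvd m})"
    by (rule has_sum_reindex_bij_witness[of _ "\<lambda>(m, d). (d, m div d - 1)" "\<lambda>(n, j). (n * Suc j, n)"])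
      (use div in \<open>auto simp: h_def simp del: mult_Suc_right\<close>)
  with T have "((\<lambda>(m, d). f d * x ^ m) has_sum T) (SIGMA m:{1..}. {d. d dvd m})"
    by blast
  from has_sum_SigmaD[OF this, of "\<lambda>m. (\<Sum>d | d dvd m. f d) * x ^ m"]
  have sum_r: "((\<lambda>m. (\<Sum>d | d dvd m. f d) * x ^ m) has_sum T) {1..}"
    by (auto simp: sum_distrib_right intro!: has_sum_finiteI)
  have "(\<Sum>q = 1..M. x ^ q\<^sup>2) \<le> T" for M
  proof -
    have "(\<Sum>q = 1..M. x ^ q\<^sup>2) = (\<Sum>m\<in>(\<lambda>q. q\<^sup>2) ` {1..M}. x ^ m)"
      by (subst sum.reindex) (auto simp: inj_on_def)
    also have "\<dots> \<le> (\<Sum>m\<in>(\<lambda>q. q\<^sup>2) ` {1..M}. (\<Sum>d | d dvd m. f d) * x ^ m)"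
      using x divisor_sum_square_ge_1 by (intro sum_mono) (auto simp: mult_le_cancel_right1)
    also have "\<dots> \<le> T"
      using x divisor_sum_nonneg by (intro finite_sum_le_has_sum[OF sum_r]) (auto simp: Suc_le_eq)
    finally show ?thesis .
  qed
  with 1 show ?thesis
    using that by blast
qed

text \<open>Monsky's argument: with \<open>b n = 1 / (n * (1 - x)) - x ^ n / (1 - x ^ n)\<close>, the vanishing
  of \<open>\<Sum> f n / n\<close> would turn the Lambert series into \<open>- (\<Sum> f n * b n)\<close>. The latter is bounded
  uniformly in \<open>x\<close> by partial summation, since \<open>b\<close> decreases from \<open>b 1 = 1\<close>, whereas the
  former is at least \<open>\<Sum> x ^ q\<^sup>2\<close>.\<close>

lemma multiplicative_not_sums_0_of_bounded_partial_sums: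
  assumes bound: "\<And>n. \<bar>\<Sum>k\<le>n. f k\<bar> \<le> B"
  shows "\<not> (\<lambda>n. f n / real n) sums 0"
proof
  assume L: "(\<lambda>n. f n / real n) sums 0"
  have *: "(\<Sum>q = 1..M. x ^ q\<^sup>2) \<le> B" if x: "0 < x" "x < 1" for x :: real and M :: nat
  proof -
    obtain T where T: "(\<lambda>n. f n * (x ^ n / (1 - x ^ n))) sums T" "\<And>M. (\<Sum>q = 1..M. x ^ q\<^sup>2) \<le> T"
      using lambert_series[OF x] by blast
    define b where "b n = 1 / (real n * (1 - x)) - x ^ n / (1 - x ^ n)" for n
    define U where "U n = (\<Sum>j<n. x ^ j)" for n
    define y where "y = sqrt x"
    have y: "0 < y" "y < 1" "x = y\<^sup>2"
      using x by (auto simp: y_def)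
    have U_ge: "real n * y ^ (n - 1) \<le> U n" for n
      using sum_power_two_sided_AM_GM[of y n] y by (simp add: U_def)
    have U_pos: "U n > 0" if "n > 0" for n
      using U_ge[of n] that y by (auto intro: less_le_trans[rotated])
    have b_eq: "(1 - x) * b n = 1 / real n - x ^ n / U n" if "n > 0" for n
    proof -
      have "1 - x ^ n = (1 - x) * U n"
        by (simp add: U_def one_diff_power_eq)
      then have "(1 - x) * b n = (1 - x) * (1 / (real n * (1 - x))) - (1 - x) * (x ^ n / ((1 - x) * U n))"
        unfolding b_def by (subst right_diff_distrib) simp
      then show ?thesis
        using x by simp
    qed
    have b_Suc: "b (Suc n) \<le> b n" if n: "n > 0" for n
    proof -
      \<comment> \<open>By this recursion the difference of consecutive quotients collapses to x^n /
        (U n U (n+1)). Two uses of \<open>U_ge\<close>, with x^n = y^(2n) \<le> y^(n-1) y^n, bound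
        it by 1/(n(n+1)), which is 1/n - 1/(n+1).\<close>
      have "U (Suc n) = 1 + x * U n"
        by (simp only: U_def sum.lessThan_Suc_shift power_0 power_Suc sum_distrib_left)
      then have "x ^ n / U n - x ^ Suc n / U (Suc n) = x ^ n / (U n * U (Suc n))"
        using U_pos[of n] U_pos[of "Suc n"] n by (simp add: field_simps)
      also have "\<dots> \<le> 1 / (real n * real (Suc n))"
      proof -
        have "x ^ n * (real n * real (Suc n)) = (real n * real (Suc n)) * y ^ (2 * n)"
          by (simp add: y power_mult)
        also have "\<dots> \<le> (real n * real (Suc n)) * y ^ ((n - 1) + n)"
          using y by (intro mult_left_mono power_decreasing) auto
        also have "\<dots> = (real n * y ^ (n - 1)) * (real (Suc n) * y ^ (Suc n - 1))"
          by (simp add: power_add)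
        also have "\<dots> \<le> U n * U (Suc n)"
          using y U_pos[of n] n by (intro mult_mono U_ge) auto
        finally have "x ^ n * (real n * real (Suc n)) \<le> U n * U (Suc n)" .
        moreover have "0 < U n * U (Suc n)" "0 < real n * real (Suc n)"
          using U_pos[of n] U_pos[of "Suc n"] n by simp_all
        moreover have "v / t \<le> 1 / w" if "v * w \<le> t" "0 < t" "0 < w" for v w t :: real
          using that by (simp add: field_simps)
        ultimately show ?thesis
          by blast
      qed
      also have "\<dots> = 1 / real n - 1 / real (Suc n)"
        using n by (simp add: field_simps)
      finally have "(1 - x) * b (Suc n) \<le> (1 - x) * b n"
        using n by (simp add: b_eq)
      then show ?thesis
        using x by simp
    qed
    have b_nonneg: "b n \<ge> 0" if n: "n > 0" for n
    proof -
      have "x ^ n * real n = real n * y ^ (2 * n)"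
        by (simp add: y power_mult)
      also have "\<dots> \<le> real n * y ^ (n - 1)"
        using y by (intro mult_left_mono power_decreasing) auto
      also have "\<dots> \<le> U n"
        by (rule U_ge)
      finally have "x ^ n / U n \<le> 1 / real n"
        using U_pos[of n] n by (simp add: field_simps)
      then have "(1 - x) * b n \<ge> 0"
        using n by (simp add: b_eq)
      then show ?thesis
        using x by (simp add: zero_le_mult_iff)
    qed
    have b_1: "b 1 = 1"
      using x by (simp add: b_def field_simps)
    \<comment> \<open>The value at 0 is multiplied by \<open>f 0 = 0\<close>; taking
      \<open>b 1\<close> there makes the sequence decrease from index 0 on.\<close>
    define c where "c n = (if n = 0 then b 1 else b n)" for n
    have "antimono c"
      using b_Suc by (intro decseq_SucI) (auto simp: c_def)
    moreover have "c n \<ge> 0" for n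
      using b_nonneg by (simp add: c_def)
    ultimately have bd: "\<bar>\<Sum>n<m. f n * c n\<bar> \<le> B * c 0" for m
      by (rule abs_sum_mult_antimono_le) (rule bound)
    have "(\<lambda>n. (f n / real n) * (1 / (1 - x)) - f n * (x ^ n / (1 - x ^ n))) sums (0 * (1 / (1 - x)) - T)"
      by (intro sums_diff sums_mult2 L T)
    moreover have "(f n / real n) * (1 / (1 - x)) - f n * (x ^ n / (1 - x ^ n)) = f n * c n" for n
      by (cases "n = 0") (auto simp: f_0 c_def b_def algebra_simps)
    ultimately have "(\<lambda>n. f n * c n) sums (-T)"
      by simp
    then have "(\<lambda>m. \<bar>\<Sum>n<m. f n * c n\<bar>) \<longlonglongrightarrow> \<bar>-T\<bar>"
      unfolding sums_def by (intro tendsto_rabs)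
    then have "\<bar>-T\<bar> \<le> B * c 0"
      using bd by (intro LIMSEQ_le_const2[of _ _ "B * c 0"]) auto
    then show ?thesis
      using T(2)[of M] by (simp add: c_def b_1[simplified])
  qed
  obtain M :: nat where M: "real M > B"
    using reals_Archimedean2 by blast
  have "((\<lambda>x. \<Sum>q = 1..M. x ^ q\<^sup>2) \<longlongrightarrow> (\<Sum>q = 1..M. (1 :: real) ^ q\<^sup>2)) (at_left 1)"
    by (intro tendsto_intros)
  moreover have "\<forall>\<^sub>F x in at_left (1 :: real). x \<in> {0<..<1}"
    by (rule eventually_at_left_real) simp
  then have "\<forall>\<^sub>F x in at_left 1. (\<Sum>q = 1..M. x ^ q\<^sup>2) \<le> B"
    by eventually_elim (rule *, auto)
  ultimately have "(\<Sum>q = 1..M. (1 :: real) ^ q\<^sup>2) \<le> B"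
    by (rule tendsto_upperbound) simp
  then show False
    using M by simp
qed

end

section \<open>The Euler product\<close>

lemma prime_nth_prime: "prime (nth_prime k)"
  and strict_mono_nth_prime: "strict_mono nth_prime"
  and range_nth_prime: "range nth_prime = {p. prime p}"
  using enumerate_in_set[of "{p :: nat. prime p}" k] strict_mono_enumerate[of "{p :: nat. prime p}"]
    range_enumerate[of "{p :: nat. prime p}"] primes_infinite
  by (auto simp: nth_prime_def)

lemma le_nth_prime: "k \<le> nth_prime k"
  using strict_mono_imp_increasing[OF strict_mono_nth_prime] .

text \<open>Inserting zeros at the non-primes preserves the order of the terms, so conditional
  convergence carries over in both directions.\<close>

lemma sums_nth_prime_iff:
  "(\<lambda>k. f (nth_prime k)) sums S \<longleftrightarrow> (\<lambda>n. if prime n then f n else 0) sums S"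
proof -
  have "(\<lambda>k. (\<lambda>n. if prime n then f n else 0) (nth_prime k)) sums S \<longleftrightarrow>
      (\<lambda>n. if prime n then f n else 0) sums S"
    by (rule sums_mono_reindex) (auto simp: strict_mono_nth_prime range_nth_prime)
  then show ?thesis
    by (simp add: prime_nth_prime)
qed

text \<open>Sieve of Eratosthenes: each factor 1 - f p removes the multiples of p from the sum. What
  survives is the term 1 and a part of the tail of an absolutely convergent series.\<close>

lemma euler_product_tendsto:
  fixes f :: "nat \<Rightarrow> complex"
  assumes mult: "\<And>a b. f (a * b) = f a * f b" and f_0: "f 0 = 0" and f_1: "f 1 = 1"
    and summ: "summable (\<lambda>n. norm (f n))"
  shows "(\<lambda>m. (\<Prod>k<m. 1 - f (nth_prime k)) * (\<Sum>n. f n)) \<longlonglongrightarrow> 1"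
proof -
  define A where "A m = {n. n > 0 \<and> (\<forall>k<m. \<not> nth_prime k dvd n)}" for m
  define S where "S m = infsum f (A m)" for m
  have nsumm: "(\<lambda>n. norm (f n)) summable_on X" for X
    using summable_nonneg_imp_summable_on[OF summ] by (rule summable_on_subset_banach) auto
  then have fsumm: "f summable_on X" for X
    by (rule Infinite_Sum.abs_summable_summable)
  have sieve: "S (Suc m) = (1 - f (nth_prime m)) * S m" for m
  proof -
    define p where "p = nth_prime m"
    have p: "prime p"
      by (simp add: p_def prime_nth_prime)
    have coprime: "\<not> nth_prime k dvd p * n \<longleftrightarrow> \<not> nth_prime k dvd n" if "k < m" for k n
    proof -
      have "nth_prime k \<noteq> p"
        using that strict_mono_nth_prime by (auto simp: p_def strict_mono_eq)
      then have "\<not> nth_prime k dvd p"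
        using p prime_nth_prime primes_dvd_imp_eq by blast
      then show ?thesis
        by (simp add: prime_dvd_mult_iff prime_nth_prime)
    qed
    \<comment> \<open>Among the numbers free of the first m primes, those divisible by the next
      prime p are exactly p times such numbers, because p is distinct from the earlier
      primes.\<close>
    have A_eq: "A m = A (Suc m) \<union> (*) p ` A m"
    proof safe
      fix n assume n: "n \<in> A m" "n \<notin> (*) p ` A m"
      have "\<not> p dvd n"
      proof
        assume "p dvd n"
        then obtain l where "n = p * l"
          by blast
        then show False
          using n coprime by (auto simp: A_def)
      qed
      then show "n \<in> A (Suc m)"
        using n by (auto simp: A_def p_def less_Suc_eq)
    qed (use p coprime in \<open>auto simp: A_def prime_gt_0_nat\<close>)
    have "A (Suc m) \<inter> (*) p ` A m = {}"
      by (auto simp: A_def p_def)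
    then have "S m = S (Suc m) + infsum f ((*) p ` A m)"
      unfolding S_def by (subst A_eq) (rule infsum_Un_disjoint[OF fsumm fsumm])
    also have "infsum f ((*) p ` A m) = f p * S m"
      unfolding S_def using p
      by (subst infsum_reindex)
        (auto simp: inj_on_def o_def mult prime_gt_0_nat intro!: infsum_cmult_right')
    finally show ?thesis
      by (simp add: p_def algebra_simps)
  qed
  have S_eq: "(\<Prod>k<m. 1 - f (nth_prime k)) * (\<Sum>n. f n) = S m" for m
  proof (induction m)
    case 0
    have "S 0 = infsum f UNIV"
      unfolding S_def by (rule infsum_cong_neutral) (auto simp: A_def f_0)
    also have "\<dots> = (\<Sum>n. f n)"
      using norm_summable_imp_has_sum[OF summ summable_sums[OF summable_norm_cancel[OF summ]]]
      by (rule infsumI)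
    finally show ?case
      by simp
  qed (simp add: sieve mult_ac)
  have "S \<longlonglongrightarrow> 1"
  proof (rule LIM_zero_cancel, rule Lim_null_comparison)
    have "norm (S m - 1) \<le> (\<Sum>n. norm (f n)) - (\<Sum>n<m. norm (f n))" for m
    proof -
      \<comment> \<open>A surviving n > 1 has a prime factor \<open>nth_prime k\<close> with k \<ge>
        m, and \<open>nth_prime k\<close> is at least k.\<close>
      have ge: "n \<ge> m" if n: "n \<in> A m - {1}" for n
      proof -
        obtain p where "prime p" "p dvd n"
          using n prime_factor_nat by blast
        moreover from this obtain k where "p = nth_prime k"
          using range_nth_prime by blast
        ultimately have "m \<le> k"
          using n by (auto simp: A_def not_less[symmetric])
        then show ?thesis
          using le_nth_prime[of k] \<open>p = _\<close> dvd_imp_le[OF \<open>p dvd n\<close>] n by (simp add: A_def)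
      qed
      have "1 \<in> A m"
        using prime_gt_1_nat[OF prime_nth_prime] by (auto simp: A_def dest: less_not_refl2)
      then have "A m = {1} \<union> (A m - {1})"
        by auto
      then have "S m = infsum f {1} + infsum f (A m - {1})"
        unfolding S_def using infsum_Un_disjoint[OF fsumm fsumm, of "{1}" "A m - {1}"] by simp
      then have "norm (S m - 1) = norm (infsum f (A m - {1}))"
        using f_1 by simp
      also have "\<dots> \<le> (\<Sum>\<^sub>\<infinity>n\<in>A m - {1}. norm (f n))"
        by (rule norm_infsum_bound[OF nsumm])
      also have "\<dots> \<le> (\<Sum>\<^sub>\<infinity>n\<in>{m..}. norm (f n))"
        using ge by (intro infsum_mono2 nsumm) auto
      also have "\<dots> = (\<Sum>\<^sub>\<infinity>n. norm (f n)) - (\<Sum>n<m. norm (f n))"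
      proof -
        have "{..<m} \<inter> {m..} = {}" "{..<m} \<union> {m..} = UNIV"
          by auto
        then show ?thesis
          using infsum_Un_disjoint[OF nsumm nsumm, of "{..<m}" "{m..}"] by simp
      qed
      also have "(\<Sum>\<^sub>\<infinity>n. norm (f n)) = (\<Sum>n. norm (f n))"
        using summ by (intro infsumI sums_nonneg_imp_has_sum summable_sums) auto
      finally show ?thesis .
    qed
    then show "\<forall>\<^sub>F m in sequentially. norm (S m - 1) \<le> (\<Sum>n. norm (f n)) - (\<Sum>n<m. norm (f n))"
      by (intro always_eventually) blast
    have "(\<lambda>m. (\<Sum>n. norm (f n)) - (\<Sum>n<m. norm (f n))) \<longlonglongrightarrow> (\<Sum>n. norm (f n)) - (\<Sum>n. norm (f n))"
      by (intro tendsto_diff tendsto_const summable_LIMSEQ summ)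
    then show "(\<lambda>m. (\<Sum>n. norm (f n)) - (\<Sum>n<m. norm (f n))) \<longlonglongrightarrow> 0"
      by simp
  qed
  then show ?thesis
    unfolding S_eq .
qed

section \<open>Non-principal characters and their L-functions\<close>

locale nonprincipal_character =
  fixes N :: nat and chi :: "nat \<Rightarrow> complex"
  assumes character: "dirichlet_character N chi"
    and nonprincipal: "chi \<noteq> principal_character N"
begin

lemma N_pos: "N > 0"
  and chi_mult: "chi (a * b) = chi a * chi b"
  and chi_add_period: "chi (a + N) = chi a"
  and chi_eq_0_iff: "chi a = 0 \<longleftrightarrow> \<not> coprime a N"
  using character by (auto simp: dirichlet_character_def)

lemma chi_1: "chi 1 = 1"
proof -
  have "chi 1 * chi 1 = chi 1" "chi 1 \<noteq> 0"
    using chi_mult[of 1 1, symmetric] chi_eq_0_iff[of 1] by simp_all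
  then show ?thesis
    by simp
qed

lemma chi_mod: "chi (a mod N) = chi a"
proof -
  have "chi (a + k * N) = chi a" for a k
  proof (induction k)
    case (Suc k)
    have "a + Suc k * N = (a + k * N) + N"
      by simp
    then show ?case
      using Suc chi_add_period by metis
  qed simp
  from this[of "a mod N" "a div N"] show ?thesis
    by (simp add: mult.commute)
qed

lemma chi_cong: "[a = b] (mod N) \<Longrightarrow> chi a = chi b"
  by (metis cong_def chi_mod)

text \<open>Only for N = 1 is 0 coprime to N, and modulo 1 the sole character is the principal
  one.\<close>

lemma chi_0: "chi 0 = 0"
proof (rule ccontr)
  assume "chi 0 \<noteq> 0"
  then have "N = 1"
    by (simp add: chi_eq_0_iff)
  then have "chi a = 1" for a
    using chi_mod[of a] chi_mod[of 1] chi_1 by simp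
  then show False
    using nonprincipal \<open>N = 1\<close> by (auto simp: principal_character_def)
qed

lemma norm_chi:
  assumes "coprime a N"
  shows "norm (chi a) = 1"
proof -
  have "chi a ^ k = chi (a ^ k)" for k
    by (induction k) (use chi_1 in \<open>auto simp: chi_mult\<close>)
  then have "chi a ^ totient N = 1"
    using chi_cong[OF euler_theorem[OF assms]] chi_1 by simp
  then have "norm (chi a) ^ totient N = 1"
    by (metis norm_power norm_one)
  then show ?thesis
    using N_pos power_eq_imp_eq_base[of "norm (chi a)" "totient N" 1] by simp
qed

lemma norm_chi_le: "norm (chi a) \<le> 1"
  using norm_chi[of a] chi_eq_0_iff[of a] by (cases "coprime a N") auto

text \<open>Multiplication by a unit b with chi b \<noteq> 1 permutes the residues, so the sum
  equals chi b times itself.\<close>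

lemma sum_chi_period: "(\<Sum>k<N. chi k) = 0"
proof -
  have "\<exists>b. coprime b N \<and> chi b \<noteq> 1"
  proof (rule ccontr)
    assume "\<not> (\<exists>b. coprime b N \<and> chi b \<noteq> 1)"
    then have "chi = principal_character N"
      using chi_eq_0_iff by (auto simp: principal_character_def fun_eq_iff)
    then show False
      using nonprincipal by blast
  qed
  then obtain b where b: "coprime b N" "chi b \<noteq> 1"
    by blast
  have "inj_on (\<lambda>k. b * k mod N) {..<N}"
  proof (rule inj_onI)
    fix i j assume *: "i \<in> {..<N}" "j \<in> {..<N}" "b * i mod N = b * j mod N"
    then have "[b * i = b * j] (mod N)"
      by (simp add: cong_def)
    then have "[i = j] (mod N)"
      using b(1) by (simp add: cong_mult_lcancel_nat)
    then show "i = j"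
      using * by (simp add: cong_def)
  qed
  moreover have "(\<lambda>k. b * k mod N) ` {..<N} \<subseteq> {..<N}"
    using N_pos by auto
  ultimately have "bij_betw (\<lambda>k. b * k mod N) {..<N} {..<N}"
    by (simp add: bij_betw_def endo_inj_surj)
  then have "(\<Sum>k<N. chi k) = (\<Sum>k<N. chi (b * k mod N))"
    by (rule sum.reindex_bij_betw[symmetric])
  also have "\<dots> = chi b * (\<Sum>k<N. chi k)"
    by (simp add: chi_mod chi_mult sum_distrib_left)
  finally have "(chi b - 1) * (\<Sum>k<N. chi k) = 0"
    by (simp add: algebra_simps)
  then show ?thesis
    using b(2) by simp
qed

lemma norm_sum_chi_le: "norm (\<Sum>k<n. chi k) \<le> real N"
proof (induction n rule: less_induct)
  case (less n)
  show ?case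
  proof (cases "n < N")
    case True
    have "norm (\<Sum>k<n. chi k) \<le> (\<Sum>k<n. 1)"
      using norm_chi_le by (intro order_trans[OF norm_sum] sum_mono) auto
    then show ?thesis
      using True by simp
  next
    case False
    define m where "m = n - N"
    have "(\<Sum>k<m + N. chi k) = (\<Sum>k<m. chi k)"
      by (induction m) (use sum_chi_period chi_add_period in auto)
    moreover have n: "n = m + N" "m < n"
      using False N_pos by (auto simp: m_def)
    moreover have "norm (\<Sum>k<m. chi k) \<le> real N"
      by (rule less.IH) (rule n)
    ultimately show ?thesis
      by simp
  qed
qed

text \<open>The L-series in by-parts form, whose locally uniform convergence for Re s > 0 gives
  holomorphy directly.\<close>

definition Lfun :: "complex \<Rightarrow> complex" where
  "Lfun s = (\<Sum>n. (\<Sum>k\<le>n. chi k) * (of_nat n powr (-s) - of_nat (Suc n) powr (-s)))"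

text \<open>The factor \<open>real n powr 0\<close> is 1 for n > 0 and 0 at n = 0; it brings the
  bound into the form required with exponent 0.\<close>

lemma norm_sum_chi_atMost_le: "norm (\<Sum>k\<le>n. chi k) \<le> real N * real n powr 0"
  using norm_sum_chi_le[of "Suc n"] by (cases "n = 0") (auto simp: chi_0 lessThan_Suc_atMost)

lemma holomorphic_on_Lfun: "Lfun holomorphic_on {s. Re s > 0}"
  unfolding Lfun_def[abs_def]
  by (rule holomorphic_on_dirichlet_series[OF chi_0 _ norm_sum_chi_atMost_le]) simp

lemma Lfun_sums: "Re s > 0 \<Longrightarrow> (\<lambda>n. chi n * of_nat n powr (-s)) sums Lfun s"
  unfolding Lfun_def
  by (rule dirichlet_series_sums[OF chi_0 _ norm_sum_chi_atMost_le]) simp_all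

lemma dirichlet_L_eq_Lfun:
  assumes "Re s > 0"
  shows "dirichlet_L s chi = Lfun s"
proof -
  have "dirichlet_L_term chi s sums Lfun s"
    unfolding dirichlet_L_term_def[abs_def]
    using Lfun_sums[OF assms] by (subst sums_Suc_iff) (simp add: chi_0)
  then show ?thesis
    by (simp add: dirichlet_L_def sums_iff)
qed

section \<open>The logarithm of the Euler product\<close>

definition prime_term :: "nat \<Rightarrow> complex \<Rightarrow> complex" where
  "prime_term n s = (if prime n then chi n * of_nat n powr (-s) else 0)"

lemma norm_prime_term_le: "norm (prime_term n s) \<le> real n powr (- Re s)"
  using norm_chi_le[of n] by (auto simp: prime_term_def norm_mult norm_of_nat_powr mult_le_cancel_right1)

text \<open>The terms of order at least 2 in the expansion of -Ln (1 - z); at non-primes it is 0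
  because Ln 1 = 0.\<close>

definition log_correction :: "nat \<Rightarrow> complex \<Rightarrow> complex" where
  "log_correction n s = - Ln (1 - prime_term n s) - prime_term n s"

text \<open>The worst case is the prime 2 at Re s = 1/2, with 1 / sqrt 2 < 3/4. The margin of 1/4
  keeps 1 - z off the branch cut of Ln and produces the factor 4 in
  \<open>norm_log_correction_le\<close>.\<close>

lemma norm_prime_term_le':
  assumes "Re s \<ge> 1/2"
  shows "norm (prime_term n s) \<le> 3/4"
proof (cases "prime n")
  case True
  have "norm (prime_term n s) \<le> real n powr (- Re s)"
    by (rule norm_prime_term_le)
  also have "\<dots> \<le> real n powr (- (1/2))"
    using assms prime_gt_0_nat[OF True] by (intro powr_mono) auto
  also have "\<dots> \<le> 2 powr (- (1/2))"
    using prime_ge_2_nat[OF True] by (intro powr_mono2') auto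
  also have "\<dots> = 1 / sqrt 2"
    by (simp add: powr_minus_divide powr_half_sqrt)
  also have "\<dots> \<le> 3/4"
  proof -
    have "4/3 \<le> sqrt 2"
      by (rule real_le_rsqrt) (simp add: power2_eq_square)
    then show ?thesis
      by (simp add: field_simps)
  qed
  finally show ?thesis .
qed (simp add: prime_term_def)

lemma norm_log_correction_le:
  assumes "Re s \<ge> 1/2"
  shows "norm (log_correction n s) \<le> 4 * real n powr (- 2 * Re s)"
proof -
  define z where "z = - prime_term n s"
  have z: "norm z \<le> 3/4" "norm z \<le> real n powr (- Re s)"
    using norm_prime_term_le'[OF assms, of n] norm_prime_term_le[of n s] by (auto simp: z_def)
  have "norm (log_correction n s) = norm (ln (1 + z) - z)"
  proof -
    have "log_correction n s = - (ln (1 + z) - z)"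
      by (simp add: log_correction_def z_def)
    then show ?thesis
      by (simp only: norm_minus_cancel)
  qed
  also have "\<dots> \<le> (norm z)\<^sup>2 / (1 - norm z)"
    using z by (intro Ln_approx_linear) auto
  also have "\<dots> \<le> (norm z)\<^sup>2 / (1/4)"
    using z by (intro divide_left_mono) auto
  also have "\<dots> \<le> 4 * (real n powr (- Re s))\<^sup>2"
    using z by (simp add: power_mono)
  also have "(real n powr (- Re s))\<^sup>2 = real n powr (- 2 * Re s)"
    by (simp add: power2_eq_square powr_add[symmetric])
  finally show ?thesis .
qed

definition log_correction_sum :: "complex \<Rightarrow> complex" where
  "log_correction_sum s = (\<Sum>n. log_correction n s)"

lemma holomorphic_on_log_correction_sum: "log_correction_sum holomorphic_on {s. Re s > 1/2}"
  and summable_log_correction: "Re s > 1/2 \<Longrightarrow> summable (\<lambda>n. log_correction n s)"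
proof -
  have bound: "norm (log_correction n s) \<le> 4 * (1 + norm s)\<^sup>2 * real n powr (1/2 - Re s - 1)"
    if "Re s > 1/2" for n s
  proof (cases "n = 0")
    case False
    have "norm (log_correction n s) \<le> 4 * real n powr (- 2 * Re s)"
      using that by (intro norm_log_correction_le) auto
    \<comment> \<open>Since Re s > 1/2, one of the two factors n^(-Re s) is at most n^(-1/2), which
      gives the shape with \<beta> = 1/2.\<close>
    also have "\<dots> \<le> (4 * (1 + norm s)\<^sup>2) * real n powr (1/2 - Re s - 1)"
      using that False by (intro mult_mono powr_mono) auto
    finally show ?thesis .
  qed (simp add: log_correction_def prime_term_def)
  have holo: "log_correction n holomorphic_on {s. Re s > 1/2}" for n
  proof -
    have "1 - prime_term n s \<notin> \<real>\<^sub>\<le>\<^sub>0" if "Re s > 1/2" for s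
    proof -
      have "Re (prime_term n s) \<le> 3/4"
        using norm_prime_term_le'[of s n] that complex_Re_le_cmod[of "prime_term n s"] by simp
      then show ?thesis
        by (auto simp: complex_nonpos_Reals_iff)
    qed
    moreover have "prime_term n holomorphic_on {s. Re s > 1/2}"
    proof (cases "prime n")
      case True
      then have "(\<lambda>s. chi n * of_nat n powr (-s)) holomorphic_on {s. Re s > 1/2}"
        by (intro holomorphic_intros) (auto simp: prime_gt_0_nat)
      then show ?thesis
        using True by (simp add: prime_term_def[abs_def])
    qed (simp add: prime_term_def[abs_def])
    ultimately show ?thesis
      unfolding log_correction_def[abs_def] by (intro holomorphic_intros) auto
  qed
  show "log_correction_sum holomorphic_on {s. Re s > 1/2}"
    unfolding log_correction_sum_def[abs_def]
    by (rule holomorphic_on_suminf_half_plane(1)[where f = log_correction, OF holo bound])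
  show "Re s > 1/2 \<Longrightarrow> summable (\<lambda>n. log_correction n s)"
    by (rule holomorphic_on_suminf_half_plane(2)[where f = log_correction, OF holo bound])
qed

text \<open>Each Euler factor is the exponential of \<open>prime_term\<close> plus
  \<open>log_correction\<close>. Conditional convergence of the prime series is therefore enough,
  and the limit is automatically nonzero.\<close>

lemma euler_product_exp:
  assumes "Re s > 1/2" and "(\<lambda>n. prime_term n s) sums P"
  shows "(\<lambda>m. \<Prod>k<m. inverse (1 - chi (nth_prime k) * of_nat (nth_prime k) powr (-s))) \<longlonglongrightarrow> exp (P + log_correction_sum s)"
proof -
  have "(\<lambda>k. prime_term (nth_prime k) s + log_correction (nth_prime k) s) sums (P + log_correction_sum s)"
  proof (rule sums_add)
    have "(\<lambda>n. if prime n then prime_term n s else 0) = (\<lambda>n. prime_term n s)"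
      by (auto simp: prime_term_def fun_eq_iff)
    then show "(\<lambda>k. prime_term (nth_prime k) s) sums P"
      using assms(2) sums_nth_prime_iff[of "\<lambda>n. prime_term n s"] by simp
    have "(\<lambda>n. if prime n then log_correction n s else 0) = (\<lambda>n. log_correction n s)"
      by (auto simp: log_correction_def prime_term_def fun_eq_iff)
    then show "(\<lambda>k. log_correction (nth_prime k) s) sums log_correction_sum s"
      using summable_sums[OF summable_log_correction[OF assms(1)]]
        sums_nth_prime_iff[of "\<lambda>n. log_correction n s"] by (simp add: log_correction_sum_def)
  qed
  then have "(\<lambda>m. exp (\<Sum>k<m. prime_term (nth_prime k) s + log_correction (nth_prime k) s)) \<longlonglongrightarrow> exp (P + log_correction_sum s)"
    unfolding sums_def by (intro tendsto_exp)
  moreover have "exp (prime_term (nth_prime k) s + log_correction (nth_prime k) s) =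
      inverse (1 - chi (nth_prime k) * of_nat (nth_prime k) powr (-s))" for k
  proof -
    have "1 - prime_term (nth_prime k) s \<noteq> 0"
      using norm_prime_term_le'[of s "nth_prime k"] assms(1) by auto
    then show ?thesis
      by (simp add: log_correction_def exp_minus) (simp add: prime_term_def prime_nth_prime)
  qed
  ultimately show ?thesis
    by (simp add: exp_sum)
qed

lemma Lfun_eq_exp:
  assumes s: "Re s > 1" and "(\<lambda>n. prime_term n s) sums P"
  shows "Lfun s = exp (P + log_correction_sum s)"
proof -
  define f where "f n = chi n * of_nat n powr (-s)" for n
  have "(\<lambda>m. (\<Prod>k<m. 1 - f (nth_prime k)) * (\<Sum>n. f n)) \<longlonglongrightarrow> 1"
  proof (rule euler_product_tendsto)
    show "f (a * b) = f a * f b" for a b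
      by (simp add: f_def chi_mult powr_times_real mult_ac)
    show "f 0 = 0" "f 1 = 1"
      using chi_1 by (auto simp: f_def)
    show "summable (\<lambda>n. norm (f n))"
    proof (rule summable_comparison_test')
      show "summable (\<lambda>n. real n powr (- Re s))"
        using s by (simp add: summable_real_powr_iff)
      show "norm (norm (f n)) \<le> real n powr (- Re s)" for n
        using mult_right_mono[OF norm_chi_le[of n], of "real n powr (- Re s)"]
        by (simp add: f_def norm_mult norm_of_nat_powr)
    qed
  qed
  moreover have "(\<Sum>n. f n) = Lfun s"
    using Lfun_sums[of s] s by (simp add: f_def sums_iff)
  ultimately have "(\<lambda>m. (\<Prod>k<m. 1 - f (nth_prime k)) * Lfun s) \<longlonglongrightarrow> 1"
    by simp
  moreover have "(\<lambda>m. \<Prod>k<m. inverse (1 - f (nth_prime k))) \<longlonglongrightarrow> exp (P + log_correction_sum s)"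
    using euler_product_exp[OF _ assms(2)] s by (simp add: f_def)
  ultimately have "(\<lambda>m. (\<Prod>k<m. inverse (1 - f (nth_prime k))) * ((\<Prod>k<m. 1 - f (nth_prime k)) * Lfun s))
      \<longlonglongrightarrow> exp (P + log_correction_sum s) * 1"
    by (intro tendsto_mult)
  moreover have cancel: "(\<Prod>k<m. inverse (1 - f (nth_prime k))) * ((\<Prod>k<m. 1 - f (nth_prime k)) * Lfun s) = Lfun s" for m
  proof -
    have "1 - f (nth_prime k) \<noteq> 0" for k
    proof -
      have "f (nth_prime k) = prime_term (nth_prime k) s"
        by (simp add: f_def prime_term_def prime_nth_prime)
      then show ?thesis
        using norm_prime_term_le'[of s "nth_prime k"] s by auto
    qed
    then have "(\<Prod>k<m. inverse (1 - f (nth_prime k))) * (\<Prod>k<m. 1 - f (nth_prime k)) = 1"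
      by (simp flip: prod.distrib)
    then show ?thesis
      by (simp flip: mult.assoc)
  qed
  ultimately have "(\<lambda>m. Lfun s) \<longlonglongrightarrow> exp (P + log_correction_sum s)"
    by (simp only: cancel mult_1_right)
  then show ?thesis
    by (simp add: LIMSEQ_const_iff)
qed

end

section \<open>Real characters\<close>

locale real_nonprincipal_character = nonprincipal_character +
  assumes real: "real_character chi"
begin

lemma chi_eq_of_real: "chi a = of_real (Re (chi a))"
  using real by (simp add: real_character_def)

lemma Re_chi_values: "Re (chi a) \<in> {-1, 0, 1}"
proof (cases "coprime a N")
  case True
  then have "\<bar>Re (chi a)\<bar> = 1"
    using norm_chi[OF True] by (subst (asm) chi_eq_of_real) simp
  then show ?thesis
    by auto
next
  case False
  then show ?thesis
    using chi_eq_0_iff[of a] by simp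
qed

lemma Lfun_1_nonzero: "Lfun 1 \<noteq> 0"
proof
  assume "Lfun 1 = 0"
  then have "(\<lambda>n. Re (chi n * of_nat n powr (-1))) sums 0"
    using sums_Re[OF Lfun_sums[of 1]] by simp
  moreover have "Re (chi n * of_nat n powr (-1)) = Re (chi n) / real n" for n
  proof -
    have "of_nat n powr (-1) = (of_real (inverse (real n)) :: complex)"
      by (simp add: powr_minus)
    then show ?thesis
      by (simp add: divide_inverse del: of_real_inverse)
  qed
  ultimately have "(\<lambda>n. Re (chi n) / real n) sums 0"
    by simp
  moreover have "\<not> (\<lambda>n. Re (chi n) / real n) sums 0"
  proof (rule multiplicative_not_sums_0_of_bounded_partial_sums)
    show "Re (chi (a * b)) = Re (chi a) * Re (chi b)" for a b
      by (subst chi_mult, subst (1 2) chi_eq_of_real) simp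
    show "\<bar>\<Sum>k\<le>n. Re (chi k)\<bar> \<le> real N" for n
      using abs_Re_le_cmod[of "\<Sum>k<Suc n. chi k"] norm_sum_chi_le[of "Suc n"]
      by (simp only: lessThan_Suc_atMost Re_sum)
  qed (use Re_chi_values chi_1 chi_0 in auto)
  ultimately show False
    by blast
qed

end

section \<open>Crossing the line \<open>Re s = 1\<close>\<close>

text \<open>By the mean value theorem each term is at most the increment of x^(1-\<sigma>) /
  (1-\<sigma>), and these increments telescope.\<close>

lemma sum_powr_minus_le:
  assumes "0 \<le> \<sigma>" "\<sigma> < 1"
  shows "(\<Sum>k=1..n. real k powr (-\<sigma>)) \<le> 1 / (1 - \<sigma>) * real n powr (1 - \<sigma>)"
proof (induction n)
  case (Suc n)
  have "(1 - \<sigma>) * real (Suc n) powr (-\<sigma>) \<le> real (Suc n) powr (1 - \<sigma>) - real n powr (1 - \<sigma>)"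
  proof (cases "n = 0")
    case False
    have "\<exists>z. real n < z \<and> z < real (Suc n) \<and> real (Suc n) powr (1 - \<sigma>) - real n powr (1 - \<sigma>) =
        (real (Suc n) - real n) * ((1 - \<sigma>) * z powr (1 - \<sigma> - 1))"
      using False by (intro MVT2 has_real_derivative_powr) auto
    then obtain z where z: "real n < z" "z < real (Suc n)"
        "real (Suc n) powr (1 - \<sigma>) - real n powr (1 - \<sigma>) = (1 - \<sigma>) * z powr (-\<sigma>)"
      by auto
    show ?thesis
      unfolding z(3) using z(1,2) assms by (intro mult_left_mono powr_mono2') auto
  qed (use assms in simp)
  then have "real (Suc n) powr (-\<sigma>) \<le> (real (Suc n) powr (1 - \<sigma>) - real n powr (1 - \<sigma>)) / (1 - \<sigma>)"
    using assms by (simp add: pos_le_divide_eq mult.commute)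
  also have "\<dots> = 1 / (1 - \<sigma>) * real (Suc n) powr (1 - \<sigma>) - 1 / (1 - \<sigma>) * real n powr (1 - \<sigma>)"
    by (simp add: diff_divide_distrib)
  finally show ?case
    using Suc by simp
qed simp

text \<open>A value \<open>u n > n powr (s - \<sigma>)\<close> forces \<open>u \<ge> n powr (s - \<sigma>) / 2\<close> on an interval of length
  about \<open>n powr s / 2\<close> to the right of \<open>n\<close>. Since \<open>s\<close> is the midpoint of \<open>s0\<close> and \<open>1\<close>, the
  corresponding block of the convergent series is bounded below by a constant.\<close>

lemma eventually_le_powr_of_summable:
  fixes u :: "nat \<Rightarrow> real"
  assumes \<sigma>: "0 \<le> \<sigma>" "\<sigma> < s0" "s0 < 1"
    and step: "\<And>n. \<bar>u (Suc n) - u n\<bar> \<le> real (Suc n) powr (-\<sigma>)"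
    and nonneg: "\<And>n. n \<ge> n0 \<Longrightarrow> u n \<ge> 0"
    and summ: "summable (\<lambda>n. (if n < n0 then 0 else u n) * real n powr (-(s0 - \<sigma> + 1)))"
  shows "\<exists>n1. \<forall>n\<ge>n1. u n \<le> real n powr ((1 + s0) / 2 - \<sigma>)"
proof -
  define s where "s = (1 + s0) / 2"
  define v where "v n = (if n < n0 then 0 else u n) * real n powr (-(s0 - \<sigma> + 1))" for n
  \<comment> \<open>The block estimate (n^s / 2) (n^(s-\<sigma>) / 2) (2n)^(-(s0-\<sigma>+1)); the
    powers of n cancel because 2s = 1 + s0.\<close>
  define c where "c = 2 powr (-(s0 - \<sigma> + 1)) / 4"
  have s: "s0 < s" "s < 1" "s + s = 1 + s0"
    using \<sigma> by (auto simp: s_def field_simps)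
  have "c > 0"
    by (simp add: c_def)
  then obtain n2 where n2: "\<And>m k. m \<ge> n2 \<Longrightarrow> norm (sum v {m..<k}) < c"
    using summ unfolding v_def[symmetric] summable_Cauchy by meson
  have "u n \<le> real n powr (s - \<sigma>)" if n: "n \<ge> Suc (max n0 n2)" for n
  proof (rule ccontr)
    assume "\<not> u n \<le> real n powr (s - \<sigma>)"
    then have un: "u n > real n powr (s - \<sigma>)"
      by simp
    \<comment> \<open>Over h steps \<open>u\<close> loses at most n^(s-\<sigma>) / 2, half of its
      assumed size. The block has h + 1 \<ge> n^s / 2 members, none beyond 2n because s < 1.\<close>
    define h where "h = nat \<lfloor>real n powr s / 2\<rfloor>"
    have h: "real h \<le> real n powr s / 2" "real n powr s / 2 \<le> real h + 1"
      unfolding h_def by (simp_all add: of_nat_nat) linarith+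
    have n_pos: "real n > 0" "real n \<ge> 1"
      using n by auto
    have "real n powr s \<le> real n powr 1"
      using n_pos s by (intro powr_mono) auto
    then have hn: "h \<le> n"
      using h n_pos by simp
    have u_ge: "u (n + j) \<ge> u n - real j * real n powr (-\<sigma>)" for j
    proof (induction j)
      case (Suc j)
      have "real (Suc (n + j)) powr (-\<sigma>) \<le> real n powr (-\<sigma>)"
        using n_pos \<sigma> by (intro powr_mono2') auto
      then have "u (Suc (n + j)) \<ge> u (n + j) - real n powr (-\<sigma>)"
        using step[of "n + j"] by linarith
      then show ?case
        using Suc by (simp add: algebra_simps)
    qed simp
    define d where "d = real n powr (s - \<sigma>) / 2 * (2 * real n) powr (-(s0 - \<sigma> + 1))"
    have v_ge: "v m \<ge> d" if m: "m \<in> {n..<n + Suc h}" for m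
    proof -
      obtain j where j: "m = n + j" "j \<le> h"
        using m nat_le_iff_add[of n m] by auto
      have "real j * real n powr (-\<sigma>) \<le> real n powr s / 2 * real n powr (-\<sigma>)"
        using j h by (intro mult_right_mono) auto
      also have "\<dots> = real n powr (s - \<sigma>) / 2"
        by (simp flip: powr_add)
      finally have "u m \<ge> real n powr (s - \<sigma>) / 2"
        using u_ge[of j] un j by simp
      moreover have "(2 * real n) powr (-(s0 - \<sigma> + 1)) \<le> real m powr (-(s0 - \<sigma> + 1))"
        using j hn n_pos \<sigma> by (intro powr_mono2') auto
      ultimately have "d \<le> u m * real m powr (-(s0 - \<sigma> + 1))"
        unfolding d_def using nonneg[of m] j n by (intro mult_mono) auto
      moreover have "\<not> m < n0"
        using j n by simp
      ultimately show ?thesis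
        by (simp add: v_def)
    qed
    have "c = real n powr s / 2 * d"
    proof -
      have "real n powr s * real n powr (s - \<sigma>) * real n powr (-(s0 - \<sigma> + 1)) = real n powr (s + (s - \<sigma>) + (-(s0 - \<sigma> + 1)))"
        by (simp only: powr_add)
      also have "s + (s - \<sigma>) + (-(s0 - \<sigma> + 1)) = 0"
        using s(3) by simp
      finally show ?thesis
        using n_pos by (simp add: c_def d_def powr_mult)
    qed
    also have "\<dots> \<le> (real h + 1) * d"
      using h by (intro mult_right_mono) (auto simp: d_def)
    also have "\<dots> = (\<Sum>m\<in>{n..<n + Suc h}. d)"
      by simp
    also have "\<dots> \<le> sum v {n..<n + Suc h}"
      using v_ge by (intro sum_mono)
    also have "\<dots> < c"
      using n2[of n "n + Suc h"] n by (simp add: abs_less_iff)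
    finally show False
      by simp
  qed
  then show ?thesis
    unfolding s_def by blast
qed

lemma Re_gt_of_ball:
  assumes "z \<in> ball (c :: complex) r"
  shows "Re z > Re c - r"
  using assms abs_Re_le_cmod[of "c - z"] by (simp add: dist_norm)

text \<open>The function exp (g - h) is constantly 1; its derivative vanishes and exp does not, so g
  - h has derivative 0.\<close>

lemma exp_eq_imp_diff_constant:
  fixes g h :: "complex \<Rightarrow> complex"
  assumes "open S" "convex S" "g holomorphic_on S" "h holomorphic_on S"
    and eq: "\<And>z. z \<in> S \<Longrightarrow> exp (g z) = exp (h z)"
  shows "\<exists>c. \<forall>z\<in>S. g z - h z = c"
proof (rule has_field_derivative_zero_constant)
  define f where "f z = g z - h z" for z
  have holo: "f holomorphic_on S"
    unfolding f_def by (intro holomorphic_intros assms)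
  fix z assume z: "z \<in> S"
  have f: "(f has_field_derivative deriv f z) (at z)"
    using holo \<open>open S\<close> z by (rule holomorphic_derivI)
  then have "((\<lambda>z. exp (f z)) has_field_derivative exp (f z) * deriv f z) (at z)"
    by (intro derivative_intros)
  moreover have "((\<lambda>z. exp (f z)) has_field_derivative 0) (at z)"
  proof (rule has_field_derivative_transform_within_open)
    show "((\<lambda>_. 1) has_field_derivative 0) (at z)"
      by simp
    show "1 = exp (f w)" if "w \<in> S" for w
      using eq[OF that] by (simp add: f_def exp_diff)
  qed (use assms z in auto)
  ultimately have "exp (f z) * deriv f z = 0"
    by (rule DERIV_unique)
  then show "((\<lambda>z. g z - h z) has_field_derivative 0) (at z within S)"
    using f unfolding f_def[abs_def] by (auto intro: has_field_derivative_at_within)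
qed (use assms in auto)

section \<open>Partial sums over primes and continuation of the prime series\<close>

context real_nonprincipal_character
begin

context
  fixes \<sigma> :: real
  assumes \<sigma>: "0 \<le> \<sigma>" "\<sigma> < 1"
begin

definition prime_coeff :: "nat \<Rightarrow> complex" where
  "prime_coeff n = prime_term n (of_real \<sigma>)"

definition prime_sum :: "nat \<Rightarrow> complex" where
  "prime_sum n = (\<Sum>k\<le>n. prime_coeff k)"

text \<open>Its argument is w = s - \<sigma>: it stands for the sum of chi p / p^s at s = \<sigma> +
  w, in by-parts form.\<close>

definition prime_series :: "complex \<Rightarrow> complex" where
  "prime_series w = (\<Sum>n. prime_sum n * (of_nat n powr (-w) - of_nat (Suc n) powr (-w)))"

lemma prime_coeff_0: "prime_coeff 0 = 0"
  by (simp add: prime_coeff_def prime_term_def)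

lemma prime_sum_0: "prime_sum 0 = 0"
  by (simp add: prime_sum_def prime_coeff_0)

lemma prime_sum_eq_of_real: "prime_sum n = of_real (Re (prime_sum n))"
proof -
  have "prime_coeff k \<in> \<real>" for k
    using real by (auto simp: prime_coeff_def prime_term_def real_character_def powr_Reals_eq
      intro!: Reals_mult nonzero_Reals_divide)
  then have "prime_sum n \<in> \<real>"
    unfolding prime_sum_def by (intro sum_in_Reals) auto
  then show ?thesis
    by simp
qed

lemma norm_prime_coeff_le: "norm (prime_coeff k) \<le> real k powr (-\<sigma>)"
  using norm_prime_term_le[of k "of_real \<sigma>"] by (simp add: prime_coeff_def)

lemma prime_coeff_mult_powr: "prime_coeff n * of_nat n powr (-w) = prime_term n (of_real \<sigma> + w)"
proof -
  have "- (of_real \<sigma> + w) = - of_real \<sigma> + - w"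
    by simp
  then show ?thesis
    by (simp only: prime_coeff_def prime_term_def powr_add) simp
qed

lemma prime_sum_eq_sum: "prime_sum n = (\<Sum>k=1..n. prime_coeff k)"
  unfolding prime_sum_def by (intro sum.mono_neutral_right) (auto simp: prime_coeff_0 not_le)

lemma norm_prime_sum_le: "norm (prime_sum n) \<le> 1 / (1 - \<sigma>) * real n powr (1 - \<sigma>)"
proof -
  have "norm (prime_sum n) \<le> (\<Sum>k=1..n. real k powr (-\<sigma>))"
    unfolding prime_sum_eq_sum by (intro order_trans[OF norm_sum] sum_mono norm_prime_coeff_le)
  also have "\<dots> \<le> 1 / (1 - \<sigma>) * real n powr (1 - \<sigma>)"
    using \<sigma> by (rule sum_powr_minus_le)
  finally show ?thesis .
qed

lemma norm_prime_sum_le_n: "norm (prime_sum n) \<le> real n"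
proof -
  have "norm (prime_sum n) \<le> (\<Sum>k=1..n. 1)"
    unfolding prime_sum_eq_sum
  proof (intro order_trans[OF norm_sum] sum_mono)
    fix k assume "k \<in> {1..n}"
    then have "real k powr (-\<sigma>) \<le> real k powr 0"
      using \<sigma> by (intro powr_mono) auto
    then show "norm (prime_coeff k) \<le> 1"
      using norm_prime_coeff_le[of k] \<open>k \<in> _\<close> by simp
  qed
  then show ?thesis
    by simp
qed

text \<open>The exponent \<beta> is left open because it is used twice: with the trivial value 1 -
  \<sigma>, giving Re s > 1, and later with the improved s1 - \<sigma>. Both concern the same
  \<open>prime_series\<close>, so the second use continues the first.\<close>

lemma
  assumes "\<beta> \<ge> 0" and bound: "\<And>n. norm (prime_sum n) \<le> C * real n powr \<beta>"
  shows holomorphic_on_prime_series: "prime_series holomorphic_on {w. Re w > \<beta>}"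
    and prime_term_sums: "Re s > \<sigma> + \<beta> \<Longrightarrow> (\<lambda>n. prime_term n s) sums prime_series (s - of_real \<sigma>)"
    and prime_series_summable: "Re w > \<beta> \<Longrightarrow> summable (\<lambda>n. prime_sum n * (of_nat n powr (-w) - of_nat (Suc n) powr (-w)))"
proof -
  note D = holomorphic_on_dirichlet_series[of prime_coeff \<beta> C, OF prime_coeff_0 assms(1) bound[unfolded prime_sum_def]]
    dirichlet_series_sums[of prime_coeff \<beta> C, OF prime_coeff_0 assms(1) bound[unfolded prime_sum_def]]
    dirichlet_series_by_parts_summable[of prime_coeff \<beta> C, OF prime_coeff_0 assms(1) bound[unfolded prime_sum_def]]
  show "prime_series holomorphic_on {w. Re w > \<beta>}"
    unfolding prime_series_def[abs_def] prime_sum_def by (rule D(1))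
  show "(\<lambda>n. prime_term n s) sums prime_series (s - of_real \<sigma>)" if "Re s > \<sigma> + \<beta>"
    using D(2)[of "s - of_real \<sigma>"] that unfolding prime_series_def prime_sum_def prime_coeff_mult_powr by simp
  show "summable (\<lambda>n. prime_sum n * (of_nat n powr (-w) - of_nat (Suc n) powr (-w)))" if "Re w > \<beta>"
    unfolding prime_sum_def by (rule D(3)) (rule that)
qed

lemma prime_term_sums_gt_1: "Re s > 1 \<Longrightarrow> (\<lambda>n. prime_term n s) sums prime_series (s - of_real \<sigma>)"
  using prime_term_sums[OF _ norm_prime_sum_le] \<sigma> by simp

definition second_diff_series :: "complex \<Rightarrow> complex" where
  "second_diff_series w = (\<Sum>n. prime_sum n * (of_nat n powr (-w) - of_nat (Suc n) powr (-w) - w * of_nat n powr (-w-1)))"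

lemma holomorphic_on_second_diff_series: "second_diff_series holomorphic_on {w. Re w > 0}"
  unfolding second_diff_series_def[abs_def] by (rule holomorphic_on_second_difference_series) (rule norm_prime_sum_le_n)

text \<open>Termwise, the by-parts weight minus its second-order error is w n^(-w-1); dividing by w
  leaves the Dirichlet series with coefficients \<open>prime_sum\<close>.\<close>

lemma prime_sum_dirichlet_series_sums:
  assumes "Re w > 1 - \<sigma>"
  shows "(\<lambda>n. prime_sum n * of_nat n powr (-(w + 1))) sums ((prime_series w - second_diff_series w) / w)"
proof -
  have "Re w > 0"
    using assms \<sigma> by simp
  then have "w \<noteq> 0"
    by auto
  have *: "(\<lambda>n. prime_sum n * (of_nat n powr (-w) - of_nat (Suc n) powr (-w)) -
     prime_sum n * (of_nat n powr (-w) - of_nat (Suc n) powr (-w) - w * of_nat n powr (-w-1))) sums (prime_series w - second_diff_series w)"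
    unfolding prime_series_def second_diff_series_def using assms \<sigma> \<open>Re w > 0\<close>
    by (intro sums_diff summable_sums prime_series_summable[OF _ norm_prime_sum_le]
        second_difference_series_summable[OF norm_prime_sum_le_n]) auto
  have "(\<lambda>n. prime_sum n * of_nat n powr (-w-1)) sums ((prime_series w - second_diff_series w) / w)"
  proof -
    have "(x * y - x * (y - w * z)) / w = x * z" for x y z
      using \<open>w \<noteq> 0\<close> by (simp add: right_diff_distrib)
    then show ?thesis
      using sums_divide[OF *, of w] by (simp only:)
  qed
  then show ?thesis
    by simp
qed

lemma euler_product_of_bound:
  assumes "s1 \<ge> 1/2" "s1 < 1" "s1 \<ge> \<sigma>"
    and bound: "\<And>n. norm (prime_sum n) \<le> C * real n powr (s1 - \<sigma>)" and s: "Re s > s1"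
  shows "(\<lambda>k. inverse (1 - chi (nth_prime k) / of_nat (nth_prime k) powr s)) has_prod dirichlet_L s chi"
proof -
  have sums: "(\<lambda>n. prime_term n z) sums prime_series (z - of_real \<sigma>)" if "Re z > s1" for z
    using that assms by (intro prime_term_sums[OF _ bound]) auto
  have "(prime_series \<circ> (\<lambda>z. z - of_real \<sigma>)) holomorphic_on {z. Re z > s1}"
    using assms by (intro holomorphic_on_compose_gen[OF _ holomorphic_on_prime_series[OF _ bound]] holomorphic_intros) auto
  then have holoP: "(\<lambda>z. prime_series (z - of_real \<sigma>)) holomorphic_on {z. Re z > s1}"
    by (simp add: o_def)
  have holoQ: "log_correction_sum holomorphic_on {z. Re z > s1}"
    using assms(1) by (intro holomorphic_on_subset[OF holomorphic_on_log_correction_sum]) auto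
  \<comment> \<open>Identity theorem: both sides are holomorphic for Re s > s1 and agree for Re s >
    1. The condition s1 \<ge> 1/2 serves \<open>log_correction_sum\<close>.\<close>
  have "Lfun s = exp (prime_series (s - of_real \<sigma>) + log_correction_sum s)"
  proof (rule analytic_continuation_open[where s = "{z. Re z > 1}" and s' = "{z. Re z > s1}"
        and f = Lfun and g = "\<lambda>z. exp (prime_series (z - of_real \<sigma>) + log_correction_sum z)"])
    show "{z. Re z > 1} \<noteq> {}"
      by (auto intro: exI[of _ 2])
    show "connected {z. Re z > s1}"
      by (intro convex_connected convex_halfspace_Re_gt)
    show "Lfun holomorphic_on {z. Re z > s1}"
      using assms(1) by (intro holomorphic_on_subset[OF holomorphic_on_Lfun]) auto
    show "(\<lambda>z. exp (prime_series (z - of_real \<sigma>) + log_correction_sum z)) holomorphic_on {z. Re z > s1}"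
      by (intro holomorphic_intros holoP holoQ)
    show "Lfun z = exp (prime_series (z - of_real \<sigma>) + log_correction_sum z)" if "z \<in> {z. Re z > 1}" for z
      using that by (intro Lfun_eq_exp prime_term_sums_gt_1) auto
  qed (use assms in \<open>auto simp: open_halfspace_Re_gt\<close>)
  moreover have "dirichlet_L s chi = Lfun s"
    using s assms by (intro dirichlet_L_eq_Lfun) auto
  moreover have "(\<lambda>m. \<Prod>k<m. inverse (1 - chi (nth_prime k) * of_nat (nth_prime k) powr (-s))) \<longlonglongrightarrow>
      exp (prime_series (s - of_real \<sigma>) + log_correction_sum s)"
    using s assms(1) by (intro euler_product_exp sums) auto
  ultimately have "(\<lambda>m. \<Prod>k<m. inverse (1 - chi (nth_prime k) / of_nat (nth_prime k) powr s)) \<longlonglongrightarrow> dirichlet_L s chi"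
      and nz: "dirichlet_L s chi \<noteq> 0"
    by (simp_all add: powr_minus divide_inverse)
  \<comment> \<open>\<open>has_prod\<close> takes partial products up to and including the index,
    hence the shift; it also demands a nonzero limit, supplied by the exponential.\<close>
  from LIMSEQ_Suc[OF this(1)] show ?thesis
    using nz by (simp add: has_prod_def raw_has_prod_def lessThan_Suc_atMost)
qed

lemma local_log_L:
  obtains \<delta> g where "\<delta> > 0" "\<delta> \<le> 1 - \<sigma>" "\<delta> \<le> 1/2"
    "g holomorphic_on ball 1 \<delta>" "\<And>z. z \<in> ball 1 \<delta> \<Longrightarrow> exp (g z) = Lfun z"
proof -
  have "open {s. Re s > 0}" "1 \<in> {s. Re s > 0}"
    by (auto simp: open_halfspace_Re_gt)
  moreover have "continuous_on {s. Re s > 0} Lfun"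
    by (intro holomorphic_on_imp_continuous_on holomorphic_on_Lfun)
  ultimately obtain e where e: "e > 0" "\<And>z. dist 1 z < e \<Longrightarrow> Lfun z \<noteq> 0"
    using continuous_on_open_avoid[of "{s. Re s > 0}" Lfun 1 0] Lfun_1_nonzero by blast
  \<comment> \<open>Radius e avoids zeros of L; 1 - \<sigma> keeps Re (s - \<sigma>) positive for
    the second differences and the division by s - \<sigma>; 1/2 keeps the disc in the domain of
    \<open>log_correction_sum\<close>.\<close>
  define \<delta> where "\<delta> = min e (min (1 - \<sigma>) (1/2))"
  have \<delta>: "\<delta> > 0" "\<delta> \<le> 1 - \<sigma>" "\<delta> \<le> 1/2" "\<delta> \<le> e"
    unfolding \<delta>_def using e(1) \<sigma>
    by (auto intro: min.coboundedI1 min.coboundedI2 simp only: min_less_iff_conj)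
  have "ball 1 \<delta> \<subseteq> {s. Re s > 0}"
    using \<delta> by (auto dest!: Re_gt_of_ball)
  then have "Lfun holomorphic_on ball 1 \<delta>"
    by (rule holomorphic_on_subset[OF holomorphic_on_Lfun])
  then obtain g where "g holomorphic_on ball 1 \<delta>" "\<And>z. z \<in> ball 1 \<delta> \<Longrightarrow> exp (g z) = Lfun z"
    using holomorphic_logarithm_exists[of "ball 1 \<delta>" Lfun 1] e(2) \<delta> by auto
  then show ?thesis
    using that \<delta> by blast
qed

text \<open>For \<open>Re s > 1\<close> the series \<open>\<Sum> prime_sum n / n powr (s - \<sigma> + 1)\<close> is
  \<open>(prime_series (s - \<sigma>) - second_diff_series (s - \<sigma>)) / (s - \<sigma>)\<close>. Up to a constant,
  \<open>prime_series (s - \<sigma>)\<close> is \<open>ln L - log_correction_sum\<close>, which continues across \<open>s = 1\<close>.\<close>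

lemma prime_sum_dirichlet_series_summable_below_1:
  fixes \<eta> :: real
  assumes nonneg: "\<And>n. n \<ge> n0 \<Longrightarrow> \<eta> * Re (prime_sum n) \<ge> 0"
  shows "\<exists>s0. 1/2 < s0 \<and> \<sigma> < s0 \<and> s0 < 1 \<and>
    summable (\<lambda>n. (if n < n0 then 0 else \<eta> * Re (prime_sum n)) * real n powr (-(s0 - \<sigma> + 1)))"
proof -
  obtain \<delta> g where \<delta>: "\<delta> > 0" "\<delta> \<le> 1 - \<sigma>" "\<delta> \<le> 1/2"
    and g: "g holomorphic_on ball 1 \<delta>" "\<And>z. z \<in> ball 1 \<delta> \<Longrightarrow> exp (g z) = Lfun z"
    by (rule local_log_L) blast
  \<comment> \<open>About this centre the disc of radius \<delta>/4 lies in Re s > 1, where the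
    series is known to converge. The disc of radius 3\<delta>/4 still lies in
    \<open>ball 1 \<delta>\<close> and reaches left to 1 - \<delta>/2, past the target 1 -
    \<delta>/4.\<close>
  define s1 where "s1 = 1 + \<delta> / 4"
  have sub: "ball (of_real s1) (\<delta> / 4) \<subseteq> ball (1::complex) \<delta>" "ball (of_real s1) (3 * \<delta> / 4) \<subseteq> ball (1::complex) \<delta>"
  proof -
    have "of_real s1 - 1 = (of_real (\<delta> / 4) :: complex)"
      by (simp add: s1_def)
    then have "dist (of_real s1) (1 :: complex) = \<delta> / 4"
      using \<delta> by (simp only: dist_norm norm_of_real)
    then show "ball (of_real s1) (\<delta> / 4) \<subseteq> ball (1::complex) \<delta>"
        "ball (of_real s1) (3 * \<delta> / 4) \<subseteq> ball (1::complex) \<delta>"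
      using \<delta> by (simp_all add: ball_subset_ball_iff)
  qed
  have gt_1: "Re z > 1" if "z \<in> ball (of_real s1) (\<delta> / 4)" for z
    using Re_gt_of_ball[OF that] by (simp add: s1_def)
  have holoP: "(\<lambda>z. prime_series (z - of_real \<sigma>)) holomorphic_on ball (of_real s1) (\<delta> / 4)"
  proof -
    have "(prime_series \<circ> (\<lambda>z. z - of_real \<sigma>)) holomorphic_on ball (of_real s1) (\<delta> / 4)"
      using \<sigma> by (intro holomorphic_on_compose_gen[OF _ holomorphic_on_prime_series[OF _ norm_prime_sum_le]] holomorphic_intros)
        (auto dest: gt_1)
    then show ?thesis
      by (simp add: o_def)
  qed
  have holoQ: "log_correction_sum holomorphic_on ball (of_real s1) (\<delta> / 4)"
    using gt_1 by (intro holomorphic_on_subset[OF holomorphic_on_log_correction_sum]) force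
  have "\<exists>c. \<forall>z\<in>ball (of_real s1) (\<delta> / 4). g z - (prime_series (z - of_real \<sigma>) + log_correction_sum z) = c"
  proof (rule exp_eq_imp_diff_constant)
    show "g holomorphic_on ball (of_real s1) (\<delta> / 4)"
      using g(1) sub(1) by (rule holomorphic_on_subset)
    show "(\<lambda>z. prime_series (z - of_real \<sigma>) + log_correction_sum z) holomorphic_on ball (of_real s1) (\<delta> / 4)"
      by (intro holomorphic_intros holoP holoQ)
    show "exp (g z) = exp (prime_series (z - of_real \<sigma>) + log_correction_sum z)" if "z \<in> ball (of_real s1) (\<delta> / 4)" for z
      using g(2)[of z] Lfun_eq_exp[OF gt_1[OF that] prime_term_sums_gt_1[OF gt_1[OF that]]] sub(1) that
      by auto
  qed auto
  then obtain c where "\<And>z. z \<in> ball (of_real s1) (\<delta> / 4) \<Longrightarrow> c = g z - (prime_series (z - of_real \<sigma>) + log_correction_sum z)"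
    by metis
  then have c: "prime_series (z - of_real \<sigma>) = g z - log_correction_sum z - c" if "z \<in> ball (of_real s1) (\<delta> / 4)" for z
    using that by (simp add: algebra_simps)
  define b where "b n = (if n < n0 then 0 else \<eta> * Re (prime_sum n))" for n
  \<comment> \<open>Here t = s - \<sigma> + 1. The finite sum removes the indices below
    \<open>n0\<close>, where the sign is not controlled.\<close>
  define F where "F t = of_real \<eta> * ((g (t - 1 + of_real \<sigma>) - log_correction_sum (t - 1 + of_real \<sigma>) - c - second_diff_series (t - 1)) / (t - 1))
      - (\<Sum>n<n0. of_real (\<eta> * Re (prime_sum n)) * of_nat n powr (-t))" for t
  have "summable (\<lambda>n. b n * real n powr (-(1 - \<delta> / 4 - \<sigma> + 1)))"
  proof (rule landau_dirichlet_series[where s = "s1 - \<sigma> + 1" and r = "\<delta> / 4" and R = "3 * \<delta> / 4" and F = F])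
    show "b n \<ge> 0" for n
      using nonneg by (simp add: b_def)
    show "\<delta> / 4 > 0"
      using \<delta> by simp
    show "(\<lambda>n. of_real (b n) * of_nat n powr (-t)) sums F t" if t: "t \<in> ball (of_real (s1 - \<sigma> + 1)) (\<delta> / 4)" for t
    proof -
      define w where "w = t - 1"
      have w: "w + of_real \<sigma> \<in> ball (of_real s1) (\<delta> / 4)"
        using t by (simp add: w_def dist_norm algebra_simps)
      then have "Re w > 1 - \<sigma>"
        using gt_1[OF w] by simp
      from sums_mult[OF prime_sum_dirichlet_series_sums[OF this], of "of_real \<eta>"]
      have "(\<lambda>n. of_real (\<eta> * Re (prime_sum n)) * of_nat n powr (-t)) sums
          (of_real \<eta> * ((g (t - 1 + of_real \<sigma>) - log_correction_sum (t - 1 + of_real \<sigma>) - c - second_diff_series (t - 1)) / (t - 1)))"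
        using c[OF w] by (simp add: w_def prime_sum_eq_of_real[symmetric] mult.assoc)
      from sums_diff[OF this sums_If_finite_set[of "{..<n0}" "\<lambda>n. of_real (\<eta> * Re (prime_sum n)) * of_nat n powr (-t)"]]
      have "(\<lambda>n. of_real (\<eta> * Re (prime_sum n)) * of_nat n powr (-t) -
          (if n \<in> {..<n0} then of_real (\<eta> * Re (prime_sum n)) * of_nat n powr (-t) else 0)) sums F t"
        by (simp only: F_def finite_lessThan)
      also have "(\<lambda>n. of_real (\<eta> * Re (prime_sum n)) * of_nat n powr (-t) -
          (if n \<in> {..<n0} then of_real (\<eta> * Re (prime_sum n)) * of_nat n powr (-t) else 0)) =
          (\<lambda>n. of_real (b n) * of_nat n powr (-t))"
        by (auto simp: b_def fun_eq_iff)
      finally show ?thesis .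
    qed
    show "F holomorphic_on ball (of_real (s1 - \<sigma> + 1)) (3 * \<delta> / 4)"
    proof -
      define B where "B = ball (of_real (s1 - \<sigma> + 1) :: complex) (3 * \<delta> / 4)"
      have in_ball: "t - 1 + of_real \<sigma> \<in> ball 1 \<delta>" if "t \<in> B" for t
      proof -
        have "t - 1 + of_real \<sigma> \<in> ball (of_real s1) (3 * \<delta> / 4)"
          using that by (simp add: B_def dist_norm algebra_simps)
        then show ?thesis
          using sub(2) by blast
      qed
      then have Re_gt: "Re (t - 1 + of_real \<sigma>) > 1 - \<delta>" if "t \<in> B" for t
        using Re_gt_of_ball[OF in_ball[OF that]] by simp
      have shift: "(\<lambda>t. t - 1 + of_real \<sigma>) holomorphic_on B" "(\<lambda>t. t - 1) holomorphic_on B"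
        by (intro holomorphic_intros)+
      have "log_correction_sum holomorphic_on ball 1 \<delta>"
        using \<delta> Re_gt_of_ball[of _ 1 \<delta>] by (intro holomorphic_on_subset[OF holomorphic_on_log_correction_sum]) force
      then have "log_correction_sum \<circ> (\<lambda>t. t - 1 + of_real \<sigma>) holomorphic_on B"
        using in_ball by (intro holomorphic_on_compose_gen[OF shift(1)]) auto
      moreover have "g \<circ> (\<lambda>t. t - 1 + of_real \<sigma>) holomorphic_on B"
        using in_ball by (intro holomorphic_on_compose_gen[OF shift(1) g(1)]) auto
      moreover have Re_pos: "Re (t - 1) > 0" if "t \<in> B" for t
        using Re_gt[OF that] \<delta> by simp
      then have "second_diff_series \<circ> (\<lambda>t. t - 1) holomorphic_on B"
        by (intro holomorphic_on_compose_gen[OF shift(2) holomorphic_on_second_diff_series]) auto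
      moreover have "t - 1 \<noteq> 0" if "t \<in> B" for t
        using Re_pos[OF that] by auto
      moreover have "(\<lambda>t. of_nat n powr (-t)) holomorphic_on B" for n
      proof (cases "n = 0")
        case False
        then show ?thesis
          by (intro holomorphic_intros) auto
      qed simp
      ultimately show ?thesis
        unfolding F_def[abs_def] B_def[symmetric] o_def
        by (intro holomorphic_on_diff holomorphic_on_mult holomorphic_on_divide holomorphic_on_sum
            holomorphic_on_const shift(2))
    qed
  qed (use \<delta> in \<open>auto simp: s1_def\<close>)
  then show ?thesis
    unfolding b_def using \<delta> by (intro exI[of _ "1 - \<delta> / 4"]) auto
qed

text \<open>The sign \<eta> treats eventually nonnegative and eventually nonpositive partial sums
  together. One-sidedness turns the upper bound from \<open>eventually_le_powr_of_summable\<close>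
  into a bound on the absolute value.\<close>

lemma prime_sum_power_saving:
  assumes \<eta>: "\<bar>\<eta>\<bar> = 1" and nonneg: "\<And>n. n \<ge> n0 \<Longrightarrow> \<eta> * Re (prime_sum n) \<ge> 0"
  shows "\<exists>s1 C. 1/2 \<le> s1 \<and> \<sigma> \<le> s1 \<and> s1 < 1 \<and> (\<forall>n. norm (prime_sum n) \<le> C * real n powr (s1 - \<sigma>))"
proof -
  obtain s0 where s0: "1/2 < s0" "\<sigma> < s0" "s0 < 1"
    and summ: "summable (\<lambda>n. (if n < n0 then 0 else \<eta> * Re (prime_sum n)) * real n powr (-(s0 - \<sigma> + 1)))"
    using prime_sum_dirichlet_series_summable_below_1[OF nonneg] by blast
  define s1 where "s1 = (1 + s0) / 2"
  have norm_prime_sum: "norm (prime_sum n) = \<bar>\<eta> * Re (prime_sum n)\<bar>" for n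
    by (subst prime_sum_eq_of_real) (simp add: abs_mult \<eta>)
  have "\<exists>n1. \<forall>n\<ge>n1. \<eta> * Re (prime_sum n) \<le> real n powr ((1 + s0) / 2 - \<sigma>)"
  proof (rule eventually_le_powr_of_summable[OF \<sigma>(1) s0(2,3) _ nonneg summ])
    fix n
    have "\<eta> * Re (prime_sum (Suc n)) - \<eta> * Re (prime_sum n) = \<eta> * Re (prime_coeff (Suc n))"
      by (simp add: prime_sum_def algebra_simps)
    then have "\<bar>\<eta> * Re (prime_sum (Suc n)) - \<eta> * Re (prime_sum n)\<bar> \<le> norm (prime_coeff (Suc n))"
      using abs_Re_le_cmod[of "prime_coeff (Suc n)"] by (simp add: abs_mult \<eta>)
    also have "\<dots> \<le> real (Suc n) powr (-\<sigma>)"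
      by (rule norm_prime_coeff_le)
    finally show "\<bar>\<eta> * Re (prime_sum (Suc n)) - \<eta> * Re (prime_sum n)\<bar> \<le> real (Suc n) powr (-\<sigma>)" .
  qed
  then obtain n1 where n1: "\<And>n. n \<ge> n1 \<Longrightarrow> \<eta> * Re (prime_sum n) \<le> real n powr (s1 - \<sigma>)"
    unfolding s1_def by blast
  \<comment> \<open>The sum covers the finitely many early indices, where n^(s1-\<sigma>) \<ge> 1
    unless n = 0; the summand 1 covers all later ones.\<close>
  define C where "C = 1 + (\<Sum>n<max n0 n1. norm (prime_sum n))"
  have "norm (prime_sum n) \<le> C * real n powr (s1 - \<sigma>)" for n
  proof (cases "n < max n0 n1")
    case True
    have "norm (prime_sum n) \<le> (\<Sum>n<max n0 n1. norm (prime_sum n))"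
      using True by (intro member_le_sum) auto
    then have C: "norm (prime_sum n) \<le> C"
      by (simp add: C_def)
    show ?thesis
    proof (cases "n = 0")
      case False
      then have "real n powr (s1 - \<sigma>) \<ge> 1"
        using s0 by (intro ge_one_powr_ge_zero) (auto simp: s1_def)
      then have "C * 1 \<le> C * real n powr (s1 - \<sigma>)"
        using C norm_ge_zero[of "prime_sum n"] by (intro mult_left_mono) linarith+
      then show ?thesis
        using C by simp
    qed (simp add: prime_sum_0)
  next
    case False
    then have "norm (prime_sum n) \<le> 1 * real n powr (s1 - \<sigma>)"
      using n1[of n] nonneg[of n] by (simp add: norm_prime_sum)
    also have "\<dots> \<le> C * real n powr (s1 - \<sigma>)"
      by (intro mult_right_mono) (auto simp: C_def intro!: sum_nonneg)
    finally show ?thesis .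
  qed
  then show ?thesis
    using s0 by (intro exI[of _ s1] exI[of _ C]) (auto simp: s1_def)
qed

lemma prime_sum_eq_prime_partial_sum: "prime_sum n = prime_partial_sum chi \<sigma> (real n)"
proof -
  have "prime_sum n = (\<Sum>k\<in>{k\<in>{..n}. prime k}. chi k * of_nat k powr (- of_real \<sigma>))"
    unfolding prime_sum_def prime_coeff_def prime_term_def by (rule sum.inter_filter[symmetric]) simp
  also have "{k\<in>{..n}. prime k} = {p. prime p \<and> real p \<le> real n}"
    by auto
  finally show ?thesis
    by (simp add: prime_partial_sum_def)
qed

lemma euler_product_of_finitely_many_sign_changes:
  assumes "finitely_many_sign_changes (\<lambda>x. Re (prime_partial_sum chi \<sigma> x))"
  shows "\<exists>\<epsilon>>0::real.
    summable (\<lambda>k. chi (nth_prime k) * of_nat (nth_prime k) powr (- of_real (1 - \<epsilon>))) \<and>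
    (\<forall>s. Re s > 1 - \<epsilon> \<longrightarrow>
       (\<lambda>k. inverse (1 - chi (nth_prime k) / of_nat (nth_prime k) powr s))
         has_prod dirichlet_L s chi)"
proof -
  obtain x0 where x0: "(\<forall>x\<ge>x0. Re (prime_partial_sum chi \<sigma> x) \<ge> 0) \<or>
      (\<forall>x\<ge>x0. Re (prime_partial_sum chi \<sigma> x) \<le> 0)"
    using assms by (auto simp: finitely_many_sign_changes_def)
  define n0 where "n0 = nat \<lceil>x0\<rceil>"
  have n0: "real n \<ge> x0" if "n \<ge> n0" for n
    using that by (simp add: n0_def ceiling_le_iff nat_le_iff)
  have "\<exists>\<eta>. \<bar>\<eta>\<bar> = 1 \<and> (\<forall>n\<ge>n0. \<eta> * Re (prime_sum n) \<ge> 0)"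
    using x0
  proof
    assume "\<forall>x\<ge>x0. Re (prime_partial_sum chi \<sigma> x) \<ge> 0"
    then show ?thesis
      using n0 by (intro exI[of _ 1]) (simp add: prime_sum_eq_prime_partial_sum)
  next
    assume "\<forall>x\<ge>x0. Re (prime_partial_sum chi \<sigma> x) \<le> 0"
    then show ?thesis
      using n0 by (intro exI[of _ "-1"]) (simp add: prime_sum_eq_prime_partial_sum)
  qed
  then obtain s1 C where s1: "1/2 \<le> s1" "\<sigma> \<le> s1" "s1 < 1"
      and bound: "\<And>n. norm (prime_sum n) \<le> C * real n powr (s1 - \<sigma>)"
    using prime_sum_power_saving by blast
  \<comment> \<open>Halving places 1 - \<epsilon> strictly to the right of s1, so the series
    converges at the point 1 - \<epsilon> itself.\<close>
  define \<epsilon> where "\<epsilon> = (1 - s1) / 2"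
  have \<epsilon>: "\<epsilon> > 0" "1 - \<epsilon> > s1"
    using s1 by (auto simp: \<epsilon>_def field_simps)
  have "(\<lambda>n. prime_term n (of_real (1 - \<epsilon>))) sums prime_series (of_real (1 - \<epsilon>) - of_real \<sigma>)"
    using s1 \<epsilon> by (intro prime_term_sums[OF _ bound]) auto
  then have "(\<lambda>k. chi (nth_prime k) * of_nat (nth_prime k) powr (- of_real (1 - \<epsilon>))) sums
      prime_series (of_real (1 - \<epsilon>) - of_real \<sigma>)"
    unfolding prime_term_def by (subst sums_nth_prime_iff)
  then have "summable (\<lambda>k. chi (nth_prime k) * of_nat (nth_prime k) powr (- of_real (1 - \<epsilon>)))"
    by (rule sums_summable)
  moreover have "(\<lambda>k. inverse (1 - chi (nth_prime k) / of_nat (nth_prime k) powr s)) has_prod dirichlet_L s chi"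
    if "Re s > 1 - \<epsilon>" for s
    using that s1 \<epsilon> by (intro euler_product_of_bound[OF s1(1,3,2) bound]) auto
  ultimately show ?thesis
    using \<epsilon>(1) by blast
qed

end

end

theorem corollary1p1:
  fixes chi :: "nat \<Rightarrow> complex" and N :: nat and \<sigma> :: real
  assumes "dirichlet_character N chi"
    and "real_character chi"
    and "chi \<noteq> principal_character N"
    and "0 \<le> \<sigma>" and "\<sigma> < 1"
    and "finitely_many_sign_changes (\<lambda>x. Re (prime_partial_sum chi \<sigma> x))"
  shows "\<exists>\<epsilon>>0::real.
    summable (\<lambda>k. chi (nth_prime k) * of_nat (nth_prime k) powr (- of_real (1 - \<epsilon>))) \<and>
    (\<forall>s. Re s > 1 - \<epsilon> \<longrightarrow>
       (\<lambda>k. inverse (1 - chi (nth_prime k) / of_nat (nth_prime k) powr s))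
         has_prod dirichlet_L s chi)"
proof -
  interpret real_nonprincipal_character N chi
    by unfold_locales fact+
  show ?thesis
    using assms(4-6) by (rule euler_product_of_finitely_many_sign_changes)
qed

end
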